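(* Let $d\ge1$, let $w_1,\dots,w_d\in\mathbb C$ satisfy $\Re(w_i)>0$ for $i=1,\dots,d$, put $\bm w=(w_1,\dots,w_d)$, let $c\in\mathbb C$ with $\Re(c)>0$, and let $M\in\mathbb N_0$. Then the analytic continuation of the homogeneous Barnes zeta function to $\Re(\alpha)>d-M-1$ is given by $$\zeta_{\rm Bh}(\alpha|\bm w)=\frac{1}{\Gamma(\alpha)\prod_{i=1}^dw_i}\sum_{k=0}^M\frac{(-1)^kB_k(-c|\bm w)\,\Gamma(\alpha-d+k)}{k!\,c^{\alpha-d+k}}-\frac{1}{\Gamma(\alpha)c^\alpha}\sum_{k=0}^{M-d}\frac{\Gamma(\alpha+k)}{k!}+J_{M,c}(\alpha|\bm w),$$ where $$\begin{aligned} J_{M,c}(\alpha|\bm w)=\frac{1}{\Gamma(\alpha)}\int_0^\infty t^{\alpha-1}\Biggl(&\frac{1}{\prod_{i=1}^d(1-{\rm e}^{-w_it})}-1\\ &-\frac{t^{-d}{\rm e}^{-ct}}{\prod_{i=1}^dw_i}\sum_{k=0}^M(-1)^kB_k(-c|\bm w)\frac{t^k}{k!}+{\rm e}^{-ct}\sum_{k=0}^{M-d}\frac{(ct)^k}{k!}\Biggr){\rm d}t . \end{aligned}$$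
   Context: $\log$ is the principal branch on the right half-plane and $z^s=\exp(s\log z)$. $\mathbb N_0=\{0,1,2,\dots\}$, $\bm n\cdot\bm w=\sum_{i=1}^dn_iw_i$. Empty sums (the sums from $k=0$ to $M-d$ when $M<d$) are zero. The homogeneous Barnes zeta function is $\zeta_{\rm Bh}(\alpha|\bm w)=\sum_{\bm n\in\mathbb N_0^d\setminus\{\bm 0\}}(\bm n\cdot\bm w)^{-\alpha}$ for $\Re(\alpha)>d$; its continuation is meromorphic with at most simple poles, located at $\alpha\in\{1,\dots,d\}$, and the identity is one of meromorphic functions of $\alpha$ on $\Re(\alpha)>d-M-1$ (quotients such as $\Gamma(\alpha-d+k)/\Gamma(\alpha)$ being interpreted as meromorphic functions, with removable singularities removed). The higher order Bernoulli polynomials $B_n(x|\bm w)$ are defined by $z^d{\rm e}^{xz}\prod_{i=1}^d\frac{w_i}{{\rm e}^{w_iz}-1}=\sum_{n\ge0}B_n(x|\bm w)\frac{z^n}{n!}$ for $|z|<2\pi/\max_i|w_i|$. *)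

theory Defs
  imports "HOL-Complex_Analysis.Complex_Analysis"
begin

text \<open>
  Throughout, the parameter vector is \<open>w 1, \<dots>, w d\<close>; values of \<open>w\<close> outside \<open>{1..d}\<close> are
  irrelevant. Multi-indices in \<open>\<nat>\<^sub>0\<^sup>d\<close> are extensional functions on \<open>{1..d}\<close>.
\<close>

definition nonzero_indices :: "nat \<Rightarrow> (nat \<Rightarrow> nat) set" where
  "nonzero_indices d = ({1..d} \<rightarrow>\<^sub>E UNIV) - {\<lambda>i\<in>{1..d}. 0}"

definition barnes_term :: "nat \<Rightarrow> (nat \<Rightarrow> complex) \<Rightarrow> complex \<Rightarrow> (nat \<Rightarrow> nat) \<Rightarrow> complex" where
  "barnes_term d w \<alpha> n = (\<Sum>i=1..d. of_nat (n i) * w i) powr (-\<alpha>)"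

definition barnes_series :: "nat \<Rightarrow> (nat \<Rightarrow> complex) \<Rightarrow> complex \<Rightarrow> complex" where
  "barnes_series d w \<alpha> = (\<Sum>\<^sub>\<infinity>n\<in>nonzero_indices d. barnes_term d w \<alpha> n)"

text \<open>
  The meromorphic continuation of the series to the whole plane. It is unique: a nicely
  meromorphic function takes its limit value at every point that is not a pole and
  \<open>0\<close> at the poles.
\<close>

definition barnes_zeta :: "nat \<Rightarrow> (nat \<Rightarrow> complex) \<Rightarrow> complex \<Rightarrow> complex" where
  "barnes_zeta d w = (THE f. f nicely_meromorphic_on UNIV \<and>
     (\<forall>\<alpha>. Re \<alpha> > real d \<longrightarrow> f \<alpha> = barnes_series d w \<alpha>))"

text \<open>
  The higher order Bernoulli polynomials, as the coefficients of their generating function.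
  At \<open>z = 0\<close> the left-hand side has a removable singularity, so this point is left out.
\<close>

definition bernoulli_coeffs ::
    "nat \<Rightarrow> (nat \<Rightarrow> complex) \<Rightarrow> complex \<Rightarrow> (nat \<Rightarrow> complex) \<Rightarrow> bool" where
  "bernoulli_coeffs d w x b \<longleftrightarrow>
     (\<forall>z. z \<noteq> 0 \<and> norm z < 2 * pi / (MAX i\<in>{1..d}. norm (w i)) \<longrightarrow>
       (\<lambda>n. b n * z ^ n / fact n) sums
         (z ^ d * exp (x * z) * (\<Prod>i=1..d. w i / (exp (w i * z) - 1))))"

definition barnes_bernoulli :: "nat \<Rightarrow> nat \<Rightarrow> (nat \<Rightarrow> complex) \<Rightarrow> complex \<Rightarrow> complex" where
  "barnes_bernoulli n d w x = (THE b. bernoulli_coeffs d w x b) n"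

text \<open>
  The quotient \<open>\<Gamma>(\<alpha> + m) / \<Gamma>(\<alpha>)\<close> as a meromorphic function of \<open>\<alpha>\<close>. Removing singularities is
  needed because \<open>Gamma\<close> takes the value \<open>0\<close> at its poles.
\<close>

definition Gamma_quot :: "int \<Rightarrow> complex \<Rightarrow> complex" where
  "Gamma_quot m = remove_sings (\<lambda>\<alpha>. Gamma (\<alpha> + of_int m) / Gamma \<alpha>)"

text \<open>
  In the sums \<open>k + d \<le> M\<close> expresses \<open>0 \<le> k \<le> M - d\<close> without truncated subtraction, so that
  they are empty for \<open>M < d\<close>.
\<close>

definition barnes_J_integrand ::
    "nat \<Rightarrow> (nat \<Rightarrow> complex) \<Rightarrow> nat \<Rightarrow> complex \<Rightarrow> complex \<Rightarrow> real \<Rightarrow> complex" where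
  "barnes_J_integrand d w M c \<alpha> t = of_real t powr (\<alpha> - 1) *
     (1 / (\<Prod>i=1..d. 1 - exp (- w i * of_real t)) - 1
      - exp (- c * of_real t) / (of_real t ^ d * (\<Prod>i=1..d. w i)) *
          (\<Sum>k\<le>M. (-1) ^ k * barnes_bernoulli k d w (-c) * of_real t ^ k / fact k)
      + exp (- c * of_real t) * (\<Sum>k | k + d \<le> M. (c * of_real t) ^ k / fact k))"

definition barnes_J ::
    "nat \<Rightarrow> (nat \<Rightarrow> complex) \<Rightarrow> nat \<Rightarrow> complex \<Rightarrow> complex \<Rightarrow> complex" where
  "barnes_J d w M c \<alpha> =
     rGamma \<alpha> * (LINT t:{0<..}|lborel. barnes_J_integrand d w M c \<alpha> t)"

definition barnes_rhs ::
    "nat \<Rightarrow> (nat \<Rightarrow> complex) \<Rightarrow> nat \<Rightarrow> complex \<Rightarrow> complex \<Rightarrow> complex" where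
  "barnes_rhs d w M c \<alpha> =
     1 / (\<Prod>i=1..d. w i) *
       (\<Sum>k\<le>M. (-1) ^ k * barnes_bernoulli k d w (-c) * Gamma_quot (int k - int d) \<alpha> /
                 (fact k * c powr (\<alpha> - of_nat d + of_nat k)))
     - 1 / c powr \<alpha> * (\<Sum>k | k + d \<le> M. Gamma_quot (int k) \<alpha> / fact k)
     + barnes_J d w M c \<alpha>"

lemma bernoulli_coeffs_unique:
  assumes "d \<ge> 1" "\<And>i. i \<in> {1..d} \<Longrightarrow> w i \<noteq> 0"
    and "bernoulli_coeffs d w x a" "bernoulli_coeffs d w x b"
  shows "a = b"
proof (rule ccontr)
  assume "a \<noteq> b"
  define R where "R = 2 * pi / (MAX i\<in>{1..d}. norm (w i))"
  have "norm (w 1) \<le> (MAX i\<in>{1..d}. norm (w i))"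
    using assms(1) by (intro Max_ge) auto
  moreover have "norm (w 1) > 0"
    using assms(1) assms(2)[of 1] by simp
  ultimately have "(MAX i\<in>{1..d}. norm (w i)) > 0" by linarith
  hence R: "R > 0" unfolding R_def by (intro divide_pos_pos) auto
  define g where "g = (\<lambda>n. (a n - b n) / fact n)"
  have sums: "(\<lambda>n. g n * z ^ n) sums 0" if "z \<noteq> 0" "norm z < R" for z
  proof -
    from assms(3,4) that have
      "(\<lambda>n. a n * z ^ n / fact n) sums
         (z ^ d * exp (x * z) * (\<Prod>i=1..d. w i / (exp (w i * z) - 1)))"
      "(\<lambda>n. b n * z ^ n / fact n) sums
         (z ^ d * exp (x * z) * (\<Prod>i=1..d. w i / (exp (w i * z) - 1)))"
      unfolding bernoulli_coeffs_def R_def by blast+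
    from sums_diff[OF this] show ?thesis
      by (simp add: g_def diff_divide_distrib left_diff_distrib)
  qed
  define F where "F = Abs_fps g"
  have "eval_fps F z = 0" if "z \<noteq> 0" "norm z < R" for z
    using sums[OF that] by (simp add: eval_fps_def F_def sums_iff)
  moreover have "fps_conv_radius F \<ge> ereal R"
    unfolding fps_conv_radius_def F_def
  proof (rule conv_radius_geI_ex)
    fix r :: real assume r: "0 < r" "ereal r < ereal R"
    have "summable (\<lambda>n. g n * of_real r ^ n)"
      using sums[of "of_real r"] r by (auto simp: sums_iff)
    thus "\<exists>z. norm z = r \<and> summable (\<lambda>n. fps_nth (Abs_fps g) n * z ^ n)"
      using r by (intro exI[of _ "of_real r"]) auto
  qed
  ultimately have ev: "eventually (\<lambda>z. eval_fps F z = 0) (at 0)"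
    using R by (auto simp: eventually_at intro!: exI[of _ R])
  have rad: "fps_conv_radius F > 0"
    using R \<open>fps_conv_radius F \<ge> ereal R\<close> by (meson ereal_less(2) order_less_le_trans)
  have lim: "eval_fps F \<midarrow>0\<rightarrow> eval_fps F 0"
    using continuous_eval_fps[of 0 F UNIV] rad by (auto simp: continuous_within zero_ereal_def)
  have "eval_fps F \<midarrow>0\<rightarrow> 0"
    using ev by (intro tendsto_eventually)
  with lim have F0: "eval_fps F 0 = 0" by (rule LIM_unique)
  have "F = 0"
  proof (rule eval_fps_eqD)
    show "eventually (\<lambda>z. eval_fps F z = eval_fps 0 z) (nhds 0)"
      using ev F0 by (auto simp: eventually_nhds_conv_at)
  qed (use rad in auto)
  hence "g = (\<lambda>_. 0)" by (auto simp: F_def fps_eq_iff)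
  hence "a n - b n = 0" for n by (auto simp: g_def fun_eq_iff)
  thus False using \<open>a \<noteq> b\<close> by auto
qed

lemma bernoulli_coeffs_exist:
  assumes "d \<ge> 1" "\<And>i. i \<in> {1..d} \<Longrightarrow> w i \<noteq> 0"
  shows "\<exists>b. bernoulli_coeffs d w x b"
proof -
  define m where "m = (MAX i\<in>{1..d}. norm (w i))"
  define R where "R = 2 * pi / m"
  have le: "norm (w i) \<le> m" if "i \<in> {1..d}" for i
    unfolding m_def using that by (intro Max_ge) auto
  have "norm (w 1) > 0" "norm (w 1) \<le> m"
    using le[of 1] assms(1) assms(2)[of 1] by simp_all
  hence m: "m > 0" by linarith
  define e :: "complex \<Rightarrow> complex" where "e = (\<lambda>u. if u = 0 then 1 else (exp u - 1) / u)"
  have e_holo: "e holomorphic_on UNIV"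
  proof -
    have "deriv exp (0::complex) = 1"
      using DERIV_imp_deriv[OF DERIV_exp[of "0 :: complex"]] by simp
    moreover have "(\<lambda>u::complex. if u = 0 then deriv exp 0 else (exp u - exp 0) / (u - 0))
        holomorphic_on UNIV"
      by (rule pole_lemma) (auto intro: holomorphic_intros)
    ultimately show ?thesis by (simp only: e_def exp_zero diff_zero)
  qed
  have e_nz: "e u \<noteq> 0" if "norm u < 2 * pi" for u
  proof
    assume "e u = 0"
    hence u: "u \<noteq> 0" "exp u = 1" by (auto simp: e_def split: if_splits)
    then obtain n :: int where n: "Re u = 0" "Im u = of_int (2 * n) * pi"
      by (auto simp: exp_eq_1)
    have "n \<noteq> 0" using n u by (auto simp: complex_eq_iff)
    hence "1 \<le> \<bar>real_of_int n\<bar>" by linarith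
    hence "2 * pi \<le> \<bar>Im u\<bar>" using n by (simp add: abs_mult)
    with that show False using abs_Im_le_cmod[of u] by linarith
  qed
  have nz: "e (w i * z) \<noteq> 0" if "i \<in> {1..d}" "z \<in> ball 0 R" for i z
  proof (rule e_nz)
    have "norm (w i * z) \<le> m * norm z"
      using le[OF that(1)] by (simp add: norm_mult mult_right_mono)
    also have "\<dots> < 2 * pi" using that(2) m by (simp add: R_def field_simps)
    finally show "norm (w i * z) < 2 * pi" .
  qed
  define G where "G = (\<lambda>z. exp (x * z) * (\<Prod>i=1..d. 1 / e (w i * z)))"
  have "(\<lambda>z. e (w i * z)) holomorphic_on ball 0 R" for i
    using holomorphic_on_compose_gen[of "\<lambda>z. w i * z" "ball 0 R" e UNIV] e_holo
    by (auto simp: o_def intro: holomorphic_intros)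
  hence "G holomorphic_on ball 0 R"
    unfolding G_def using nz by (intro holomorphic_intros) auto
  hence sums: "(\<lambda>n. (deriv ^^ n) G 0 / fact n * (z - 0) ^ n) sums G z" if "z \<in> ball 0 R" for z
    using that by (rule holomorphic_power_series)
  have G_eq: "G z = z ^ d * exp (x * z) * (\<Prod>i=1..d. w i / (exp (w i * z) - 1))"
    if "z \<noteq> 0" for z
  proof -
    have "(\<Prod>i=1..d. 1 / e (w i * z)) = (\<Prod>i=1..d. z * (w i / (exp (w i * z) - 1)))"
      using that assms(2) by (intro prod.cong) (auto simp: e_def)
    also have "\<dots> = z ^ d * (\<Prod>i=1..d. w i / (exp (w i * z) - 1))"
      by (simp only: prod.distrib prod_constant) simp
    finally show ?thesis by (simp add: G_def)
  qed
  have "bernoulli_coeffs d w x (\<lambda>n. (deriv ^^ n) G 0)"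
    unfolding bernoulli_coeffs_def m_def[symmetric] R_def[symmetric]
  proof (intro allI impI, elim conjE)
    fix z :: complex assume z: "z \<noteq> 0" "norm z < R"
    from sums[of z] z(2) have "(\<lambda>n. (deriv ^^ n) G 0 * z ^ n / fact n) sums G z" by simp
    thus "(\<lambda>n. (deriv ^^ n) G 0 * z ^ n / fact n) sums
        (z ^ d * exp (x * z) * (\<Prod>i=1..d. w i / (exp (w i * z) - 1)))"
      by (simp only: G_eq[OF z(1)])
  qed
  thus ?thesis by blast
qed

lemma bernoulli_coeffs_barnes_bernoulli:
  assumes "d \<ge> 1" "\<And>i. i \<in> {1..d} \<Longrightarrow> w i \<noteq> 0"
  shows "bernoulli_coeffs d w x (\<lambda>n. barnes_bernoulli n d w x)"
proof -
  have "\<exists>!b. bernoulli_coeffs d w x b"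
  proof (rule ex_ex1I)
    show "\<exists>b. bernoulli_coeffs d w x b"
      using assms by (rule bernoulli_coeffs_exist)
    show "a = b" if "bernoulli_coeffs d w x a" "bernoulli_coeffs d w x b" for a b
      using assms that by (rule bernoulli_coeffs_unique)
  qed
  from theI'[OF this] show ?thesis by (simp add: barnes_bernoulli_def)
qed

end

theory Submission
  imports Defs
begin

text \<open>
  For \<open>Re \<alpha> > d\<close> the Mellin transform of \<open>h t - 1\<close>, where \<open>h t = 1 / (\<Prod>i=1..d. 1 - exp (- w i * t))\<close>
  is a product of geometric series, equals \<open>\<Gamma>(\<alpha>)\<close> times the Barnes series. Subtracting the
  terms of order at most \<open>M - d\<close> at \<open>t = 0\<close>, damped by \<open>exp (- c * t)\<close>, leaves a remainder
  \<open>O(t powr (M + 1 - d))\<close> whose Mellin transform is holomorphic for \<open>Re \<alpha> > d - M - 1\<close>, while the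
  subtracted terms have explicit Gamma integrals. After multiplication by
  \<open>(\<alpha> - 1) \<cdots> (\<alpha> - d)\<close> the formulas for all \<open>M\<close> are holomorphic and, by the identity theorem,
  restrictions of one entire function; dividing it again gives the continuation.
\<close>

section \<open>Holomorphy of parameter integrals\<close>

text \<open>\<open>barnes_zeta\<close> is singled out among functions on the whole plane, so even
  the formula for one \<open>M\<close> needs the formulas for all \<open>M\<close>: only together do
  their half-planes exhaust the plane. A single factor clears the poles of every term because each
  quotient of \<Gamma>(\<alpha> - d + k) by \<Gamma>(\<alpha>) is a ratio of Pochhammer polynomials
  with the same denominator \<open>pochhammer (\<alpha> - of_nat d) d\<close>; hence the gluing
  takes place among holomorphic functions. The damping is there because a bare power of
  \<open>t\<close> has no Mellin integral over the half-line. It has to be compensated: the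
  coefficients are those of \<open>exp (c * t) * h t\<close>, which is why the Bernoulli polynomials
  are taken at \<open>-c\<close>, and \<open>1 = exp (- c * t) * exp (c * t)\<close> produces the
  second finite sum. Since the weights are complex, absolute convergence is reduced to real parts
  through the Gamma integral: the norm of \<open>exp (- z * t)\<close> is
  \<open>exp (- Re z * t)\<close>. Both the bound for the complex powers and the exchange of sum and
  integral then rest on one lattice sum of positive reals.\<close>

lemma holomorphic_integral_dominated:
  fixes f :: "complex \<Rightarrow> 'a \<Rightarrow> complex"
  assumes "open S"
    and hol: "\<And>x. x \<in> space M \<Longrightarrow> (\<lambda>z. f z x) holomorphic_on S"
    and meas: "\<And>z. z \<in> S \<Longrightarrow> f z \<in> borel_measurable M"
    and dom: "\<And>z. z \<in> S \<Longrightarrow> \<exists>r>0. \<exists>g. integrable M g \<and>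
                (\<forall>y\<in>ball z r. \<forall>x\<in>space M. norm (f y x) \<le> g x)"
  shows "(\<lambda>z. \<integral>x. f z x \<partial>M) holomorphic_on S"
proof (subst holomorphic_on_open[OF \<open>open S\<close>], intro ballI)
  fix z assume z: "z \<in> S"
  obtain r g where r: "r > 0" and g: "integrable M g"
    and le: "\<And>y x. y \<in> ball z r \<Longrightarrow> x \<in> space M \<Longrightarrow> norm (f y x) \<le> g x"
    using dom[OF z] by blast
  obtain R where R: "R > 0" "ball z R \<subseteq> S"
    using \<open>open S\<close> z open_contains_ball by blast
  \<comment> \<open>With a third, closed discs of radius \<open>\<rho>\<close> around points of
    \<open>ball z \<rho>\<close> stay within two thirds of \<open>min r R\<close> from
    \<open>z\<close>. There \<open>g\<close> dominates, and Cauchy's inequality bounds all these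
    derivatives by \<open>g x / \<rho>\<close>.\<close>
  define \<rho> where "\<rho> = min r R / 3"
  have \<rho>: "\<rho> > 0" using r R by (simp add: \<rho>_def)
  have sub: "cball y \<rho> \<subseteq> ball z r" "cball y \<rho> \<subseteq> S" if "y \<in> ball z \<rho>" for y
  proof -
    have "cball y \<rho> \<subseteq> ball z (min r R)"
    proof
      fix u assume "u \<in> cball y \<rho>"
      moreover have "dist z u \<le> dist z y + dist y u" by (rule dist_triangle)
      ultimately show "u \<in> ball z (min r R)" using that \<rho> by (simp add: \<rho>_def)
    qed
    thus "cball y \<rho> \<subseteq> ball z r" "cball y \<rho> \<subseteq> S" using R by (auto simp: subset_iff)
  qed
  have inS: "y \<in> S" if "y \<in> ball z \<rho>" for y
    using sub[OF that] \<rho> by auto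
  have deriv_le: "norm (deriv (\<lambda>y. f y x) y) \<le> g x / \<rho>" if "y \<in> ball z \<rho>" "x \<in> space M" for x y
  proof -
    have "norm ((deriv ^^ 1) (\<lambda>y. f y x) y) \<le> fact 1 * g x / \<rho> ^ 1"
    proof (rule Cauchy_inequality)
      show "(\<lambda>y. f y x) holomorphic_on ball y \<rho>"
        using hol[OF that(2)] sub[OF that(1)] by (meson ball_subset_cball holomorphic_on_subset)
      show "continuous_on (cball y \<rho>) (\<lambda>y. f y x)"
        using hol[OF that(2)] sub[OF that(1)]
        by (meson holomorphic_on_subset holomorphic_on_imp_continuous_on)
      show "norm (f u x) \<le> g x" if "norm (y - u) = \<rho>" for u
        using sub(1)[OF \<open>y \<in> ball z \<rho>\<close>] that \<open>x \<in> space M\<close> by (intro le) (auto simp: dist_norm)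
    qed fact
    thus ?thesis by simp
  qed
  have hd: "((\<lambda>y. f y x) has_field_derivative deriv (\<lambda>y. f y x) y) (at y)"
    if "y \<in> ball z \<rho>" "x \<in> space M" for x y
    using hol[OF that(2)] inS[OF that(1)] \<open>open S\<close> by (intro holomorphic_derivI)
  have quot_le: "norm ((f y x - f z x) / (y - z)) \<le> g x / \<rho>"
    if "y \<in> ball z \<rho>" "y \<noteq> z" "x \<in> space M" for x y
  proof -
    have "norm (f y x - f z x) \<le> g x / \<rho> * norm (y - z)"
      using that \<rho> hd deriv_le
      by (intro field_differentiable_bound[of "ball z \<rho>" "\<lambda>y. f y x" "\<lambda>y. deriv (\<lambda>y. f y x) y"])
         (auto intro: has_field_derivative_at_within)
    thus ?thesis using that by (simp add: norm_divide field_simps)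
  qed
  have int: "integrable M (f y)" if "y \<in> ball z \<rho>" for y
    using sub(1)[OF that] \<rho>
    by (intro Bochner_Integration.integrable_bound[OF g] meas inS that)
       (auto intro!: AE_I2 order.trans[OF le abs_ge_self])
  let ?D = "\<lambda>x. deriv (\<lambda>y. f y x) z"
  \<comment> \<open>Dominated convergence works along sequences; taking the limit within the ball
    keeps each sequence where \<open>quot_le\<close> applies.\<close>
  have "((\<lambda>y. ((\<integral>x. f y x \<partial>M) - (\<integral>x. f z x \<partial>M)) / (y - z)) \<longlongrightarrow> (\<integral>x. ?D x \<partial>M))
          (at z within ball z \<rho>)"
    unfolding tendsto_at_iff_sequentially
  proof (intro allI impI)
    fix X assume X: "\<forall>i. X i \<in> ball z \<rho> - {z}" "X \<longlonglongrightarrow> z"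
    let ?q = "\<lambda>i x. (f (X i) x - f z x) / (X i - z)"
    have zb: "z \<in> ball z \<rho>" using \<rho> by simp
    have [measurable]: "f (X i) \<in> borel_measurable M" "f z \<in> borel_measurable M" for i
      using X(1) by (auto intro!: meas inS zb)
    have lim: "(\<lambda>i. ?q i x) \<longlonglongrightarrow> ?D x" if "x \<in> space M" for x
    proof -
      have "((\<lambda>y. (f y x - f z x) / (y - z)) \<longlongrightarrow> ?D x) (at z)"
        using hd[OF zb that] by (simp add: has_field_derivative_iff)
      moreover have "filterlim X (at z) sequentially"
        using X by (auto simp: filterlim_at)
      ultimately show ?thesis by (rule filterlim_compose)
    qed
    have "(\<lambda>i. \<integral>x. ?q i x \<partial>M) \<longlonglongrightarrow> (\<integral>x. ?D x \<partial>M)"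
    proof (rule integral_dominated_convergence[where w = "\<lambda>x. g x / \<rho>"])
      show "?D \<in> borel_measurable M"
        by (rule borel_measurable_LIMSEQ_metric[of ?q]) (use lim in auto)
    qed (use X(1) quot_le lim g in \<open>auto intro!: AE_I2\<close>)
    moreover have "(\<integral>x. ?q i x \<partial>M) = ((\<integral>x. f (X i) x \<partial>M) - (\<integral>x. f z x \<partial>M)) / (X i - z)" for i
      using X(1) zb by (simp add: int)
    ultimately show "((\<lambda>y. ((\<integral>x. f y x \<partial>M) - (\<integral>x. f z x \<partial>M)) / (y - z)) \<circ> X) \<longlonglongrightarrow> (\<integral>x. ?D x \<partial>M)"
      by (simp only: o_def)
  qed
  hence "((\<lambda>z. \<integral>x. f z x \<partial>M) has_field_derivative (\<integral>x. ?D x \<partial>M)) (at z within ball z \<rho>)"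
    by (simp add: has_field_derivative_iff)
  thus "\<exists>D. ((\<lambda>z. \<integral>x. f z x \<partial>M) has_field_derivative D) (at z)"
    using \<rho> by (subst (asm) at_within_open) auto
qed

section \<open>The Gamma integral with a complex scale\<close>

definition gamma_kernel :: "complex \<Rightarrow> complex \<Rightarrow> real \<Rightarrow> complex" where
  "gamma_kernel s z t = of_real t powr (s - 1) * exp (- z * of_real t)"

lemma norm_gamma_kernel:
  "t > 0 \<Longrightarrow> norm (gamma_kernel s z t) = t powr (Re s - 1) * exp (- Re z * t)"
  by (simp add: gamma_kernel_def norm_mult norm_powr_real_powr)

lemma gamma_kernel_measurable:
  "(\<lambda>t. indicator {0<..} t *\<^sub>R gamma_kernel s z t) \<in> borel_measurable borel"
  unfolding gamma_kernel_def
  by (intro borel_measurable_continuous_on_indicator continuous_intros) auto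

text \<open>The norm sees only \<open>Re z\<close>, so the kernel with real scale
  \<open>Re z\<close> dominates. Its integrability is first obtained for the completed measure and
  passes to \<open>lborel\<close> because the kernel is Borel measurable.\<close>

lemma gamma_kernel_integrable:
  assumes "Re s > 0" "Re z > 0"
  shows "set_integrable lborel {0<..} (gamma_kernel s z)"
proof -
  let ?g = "\<lambda>t. indicator {0<..} t *\<^sub>R gamma_kernel s (of_real (Re z)) t"
  have "integrable (completion lborel) ?g"
    using absolutely_integrable_Gamma_integral[OF assms]
    unfolding set_integrable_def gamma_kernel_def
    by (rule back_subst[of "integrable (completion lborel)"])
       (simp add: fun_eq_iff exp_minus divide_inverse exp_of_real flip: of_real_mult)
  hence "integrable lborel ?g"
    using gamma_kernel_measurable by (subst (asm) integrable_completion) auto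
  thus ?thesis
    unfolding set_integrable_def
  proof (rule Bochner_Integration.integrable_bound)
    show "AE t in lborel. norm (indicator {0<..} t *\<^sub>R gamma_kernel s z t) \<le> norm (?g t)"
      by (intro AE_I2) (auto simp: indicator_def norm_gamma_kernel)
  qed (use gamma_kernel_measurable in auto)
qed

lemma holomorphic_gamma_kernel_integral:
  assumes "Re s > 0"
  shows "(\<lambda>z. LINT t:{0<..}|lborel. gamma_kernel s z t) holomorphic_on {z. Re z > 0}"
  unfolding set_lebesgue_integral_def
proof (rule holomorphic_integral_dominated)
  show "open {z. Re z > 0}" by (rule open_halfspace_Re_gt)
  show "(\<lambda>z. indicator {0<..} t *\<^sub>R gamma_kernel s z t) holomorphic_on {z. Re z > 0}" for t
    unfolding gamma_kernel_def scaleR_conv_of_real by (intro holomorphic_intros)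
  show "(\<lambda>t. indicator {0<..} t *\<^sub>R gamma_kernel s z t) \<in> borel_measurable lborel" for z
    using gamma_kernel_measurable by simp
  fix z :: complex assume z: "z \<in> {z. Re z > 0}"
  \<comment> \<open>On \<open>ball z a\<close> the real part stays above \<open>a\<close>, so the
    kernel with scale \<open>a\<close> dominates the whole neighbourhood.\<close>
  define a where "a = Re z / 2"
  have a: "a > 0" using z by (simp add: a_def)
  let ?g = "\<lambda>t. norm (indicator {0<..} t *\<^sub>R gamma_kernel s (of_real a) t)"
  have "integrable lborel ?g"
    using gamma_kernel_integrable[of s "of_real a"] assms a
    unfolding set_integrable_def by (intro integrable_norm) auto
  moreover have "norm (indicator {0<..} t *\<^sub>R gamma_kernel s y t) \<le> ?g t" if "y \<in> ball z a" for y t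
  proof -
    have "\<bar>Re (z - y)\<bar> < a"
      using abs_Re_le_cmod[of "z - y"] that by (simp add: dist_norm)
    hence "Re y \<ge> a" unfolding a_def minus_complex.sel by linarith
    thus ?thesis by (auto simp: indicator_def norm_gamma_kernel)
  qed
  ultimately show "\<exists>r>0. \<exists>g. integrable lborel g \<and> (\<forall>y\<in>ball z r. \<forall>t\<in>space lborel.
      norm (indicator {0<..} t *\<^sub>R gamma_kernel s y t) \<le> g t)"
    using a by blast
qed

lemma gamma_kernel_integral_1:
  assumes "Re s > 0"
  shows "(LINT t:{0<..}|lborel. gamma_kernel s 1 t) = Gamma s"
proof -
  have "(LINT t:{0<..}|lborel. gamma_kernel s 1 t) = integral {0<..} (gamma_kernel s 1)"
    using gamma_kernel_integrable[of s 1] assms by (intro set_borel_integral_eq_integral) auto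
  also have "\<dots> = integral {0<..} (\<lambda>t. of_real t powr (s - 1) / of_real (exp t))"
    by (intro arg_cong[where f = "integral _"])
       (simp add: gamma_kernel_def fun_eq_iff exp_minus divide_inverse exp_of_real)
  also have "\<dots> = Gamma s"
    using Gamma_integral_complex'[OF assms] by (rule integral_unique)
  finally show ?thesis .
qed

lemma gamma_kernel_integral_real:
  assumes "Re s > 0" "a > 0"
  shows "(LINT t:{0<..}|lborel. gamma_kernel s (of_real a) t) = Gamma s * of_real a powr (-s)"
proof -
  have "Gamma s = (LINT t:{0<..}|lborel. gamma_kernel s 1 t)"
    using gamma_kernel_integral_1[OF assms(1)] by simp
  also have "\<dots> = \<bar>a\<bar> *\<^sub>R (\<integral>t. indicator {0<..} (0 + a * t) *\<^sub>R gamma_kernel s 1 (0 + a * t) \<partial>lborel)"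
    unfolding set_lebesgue_integral_def using assms by (intro lborel_integral_real_affine) auto
  also have "(\<lambda>t. indicator {0<..} (0 + a * t) *\<^sub>R gamma_kernel s 1 (0 + a * t)) =
             (\<lambda>t. of_real a powr (s - 1) * (indicator {0<..} t *\<^sub>R gamma_kernel s (of_real a) t))"
    using assms
    by (auto simp: fun_eq_iff indicator_def gamma_kernel_def powr_times_real zero_less_mult_iff)
  also have "\<bar>a\<bar> *\<^sub>R (\<integral>t. of_real a powr (s - 1) * (indicator {0<..} t *\<^sub>R gamma_kernel s (of_real a) t) \<partial>lborel)
     = of_real a powr s * (LINT t:{0<..}|lborel. gamma_kernel s (of_real a) t)"
    using assms by (simp add: set_lebesgue_integral_def scaleR_conv_of_real powr_diff)
  finally show ?thesis using assms by (simp add: powr_minus field_simps)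
qed

text \<open>For a real scale this is a linear substitution. For complex \<open>z\<close> a
  substitution would rotate the path of integration; instead both sides are holomorphic on the right
  half-plane, which avoids the branch cut of \<open>powr\<close>, and they agree on the positive
  reals, which accumulate at \<open>1\<close>.\<close>

lemma gamma_kernel_integral:
  assumes "Re s > 0" "Re z > 0"
  shows "(LINT t:{0<..}|lborel. gamma_kernel s z t) = Gamma s * z powr (-s)"
proof -
  let ?S = "{z. Re z > 0}"
  let ?U = "complex_of_real ` {0<..}"
  have "(LINT t:{0<..}|lborel. gamma_kernel s z t) - Gamma s * z powr (-s) = 0"
  proof (rule analytic_continuation[where w = z and S = ?S
      and f = "\<lambda>z. (LINT t:{0<..}|lborel. gamma_kernel s z t) - Gamma s * z powr (-s)" and U = ?U and \<xi> = 1])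
    show "(\<lambda>z. (LINT t:{0<..}|lborel. gamma_kernel s z t) - Gamma s * z powr (-s)) holomorphic_on ?S"
      using assms
      by (intro holomorphic_intros holomorphic_gamma_kernel_integral)
         (auto simp: complex_nonpos_Reals_iff)
    show "open ?S" by (rule open_halfspace_Re_gt)
    show "connected ?S" by (intro convex_connected convex_halfspace_Re_gt)
    have "(1::real) islimpt {0<..}"
      by (rule interior_limit_point) (simp add: interior_open)
    hence "\<exists>f. (\<forall>n. f n \<in> {0<..} - {1::real}) \<and> f \<longlonglongrightarrow> 1"
      by (simp add: islimpt_sequential)
    then obtain f where f: "\<And>n. f n \<in> {0<..} - {1::real}" "f \<longlonglongrightarrow> 1" by blast
    have "(\<lambda>n. complex_of_real (f n)) \<longlonglongrightarrow> of_real 1" by (intro tendsto_of_real f)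
    thus "(1::complex) islimpt ?U"
      using f(1) unfolding islimpt_sequential
      by (intro exI[of _ "\<lambda>n. complex_of_real (f n)"]) auto
  qed (use assms gamma_kernel_integral_real in auto)
  thus ?thesis by simp
qed


lemma integral_norm_gamma_kernel:
  assumes "Re s > 0" "Re z > 0"
  shows "(\<integral>t. norm (indicator {0<..} t *\<^sub>R gamma_kernel s z t) \<partial>lborel) =
           Gamma (Re s) * Re z powr (- Re s)"
proof -
  let ?f = "\<lambda>t. indicator {0<..} t *\<^sub>R gamma_kernel (of_real (Re s)) (of_real (Re z)) t"
  have "(\<integral>t. norm (indicator {0<..} t *\<^sub>R gamma_kernel s z t) \<partial>lborel) = (\<integral>t. Re (?f t) \<partial>lborel)"
  proof (intro Bochner_Integration.integral_cong refl)
    fix t :: real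
    have "gamma_kernel (of_real (Re s)) (of_real (Re z)) t = of_real (t powr (Re s - 1) * exp (- Re z * t))" if "t > 0"
      using that powr_of_real[of t "Re s - 1"]
      by (simp add: gamma_kernel_def exp_of_real flip: of_real_mult of_real_minus)
    thus "norm (indicator {0<..} t *\<^sub>R gamma_kernel s z t) = Re (?f t)"
      by (auto simp: indicator_def norm_gamma_kernel)
  qed
  also have "\<dots> = Re (\<integral>t. ?f t \<partial>lborel)"
    using gamma_kernel_integrable[of "of_real (Re s)" "of_real (Re z)"] assms
    by (intro integral_Re) (auto simp: set_integrable_def)
  also have "(\<integral>t. ?f t \<partial>lborel) = Gamma (of_real (Re s)) * of_real (Re z) powr (- of_real (Re s))"
    using gamma_kernel_integral_real[of "of_real (Re s)" "Re z"] assms by (simp add: set_lebesgue_integral_def)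
  also have "\<dots> = of_real (Gamma (Re s) * Re z powr (- Re s))"
    using assms powr_of_real[of "Re z" "- Re s"] by (simp add: Gamma_complex_of_real)
  finally show ?thesis by simp
qed

text \<open>Moving the norm inside the Gamma integral replaces any estimate of the argument of
  \<open>z\<close>. What matters is that the constant depends on \<open>s\<close> alone, so the
  bound can be summed over all multi-indices.\<close>

lemma norm_powr_le_Re_powr:
  assumes "Re s > 0" "Re z > 0"
  shows "norm (z powr (-s)) \<le> Gamma (Re s) / norm (Gamma s) * Re z powr (- Re s)"
proof -
  have nz: "Gamma s \<noteq> 0"
    using assms(1) by (auto simp: Gamma_eq_zero_iff elim!: nonpos_Ints_cases)
  have "norm (Gamma s * z powr (-s)) \<le> Gamma (Re s) * Re z powr (- Re s)"
    unfolding gamma_kernel_integral[OF assms, symmetric] integral_norm_gamma_kernel[OF assms, symmetric]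
    unfolding set_lebesgue_integral_def by (rule integral_norm_bound)
  thus ?thesis using nz by (simp add: norm_mult field_simps)
qed

section \<open>The Barnes series as a Mellin transform\<close>

lemma nonzero_indicesD:
  assumes "n \<in> nonzero_indices d"
  shows "n \<in> {1..d} \<rightarrow>\<^sub>E UNIV" "\<exists>j\<in>{1..d}. n j > 0"
proof -
  show n: "n \<in> {1..d} \<rightarrow>\<^sub>E UNIV" using assms by (simp add: nonzero_indices_def)
  show "\<exists>j\<in>{1..d}. n j > 0"
  proof (rule ccontr)
    assume "\<not> ?thesis"
    hence "n = (\<lambda>i\<in>{1..d}. 0)" using n by (intro ext) (auto simp: PiE_def extensional_def restrict_def)
    thus False using assms by (simp add: nonzero_indices_def)
  qed
qed

lemma dot_pos:
  fixes r :: "nat \<Rightarrow> real"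
  assumes "n \<in> nonzero_indices d" "\<And>i. i \<in> {1..d} \<Longrightarrow> r i > 0"
  shows "(\<Sum>i=1..d. real (n i) * r i) > 0"
proof -
  obtain j where j: "j \<in> {1..d}" "n j > 0" using nonzero_indicesD(2)[OF assms(1)] by blast
  have "0 < real (n j) * r j" using j assms(2) by simp
  also have "\<dots> \<le> (\<Sum>i=1..d. real (n i) * r i)"
    using j(1) order.strict_implies_order[OF assms(2)]
    by (intro member_le_sum) (auto intro!: mult_nonneg_nonneg)
  finally show ?thesis .
qed

lemma countable_infinite_nonzero_indices:
  assumes "d \<ge> 1"
  shows "countable (nonzero_indices d)" "infinite (nonzero_indices d)"
proof -
  show "countable (nonzero_indices d)"
    unfolding nonzero_indices_def by (intro countable_Diff countable_PiE) auto
  let ?g = "\<lambda>k::nat. \<lambda>i\<in>{1..d}. Suc k"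
  have "inj ?g"
  proof (rule injI)
    fix a b assume "?g a = ?g b"
    from fun_cong[OF this, of 1] show "a = b" using assms by simp
  qed
  moreover have "?g k \<in> nonzero_indices d" for k
    using assms by (auto simp: nonzero_indices_def fun_eq_iff intro!: exI[of _ 1])
  ultimately show "infinite (nonzero_indices d)"
    by (meson finite_subset image_subsetI infinite_UNIV_nat finite_imageD)
qed

lemma summable_on_dot_powr:
  fixes r :: "nat \<Rightarrow> real"
  assumes "d \<ge> 1" "\<And>i. i \<in> {1..d} \<Longrightarrow> r i > 0" "s > real d"
  shows "(\<lambda>n. (\<Sum>i=1..d. real (n i) * r i) powr (-s)) summable_on nonzero_indices d"
proof -
  define \<rho> where "\<rho> = Min (r ` {1..d})"
  have \<rho>: "\<rho> > 0" using assms(1,2) by (simp add: \<rho>_def)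
  have \<rho>_le: "\<rho> \<le> r i" if "i \<in> {1..d}" for i using that by (simp add: \<rho>_def)
  define p where "p = s / real d"
  have p: "p > 1" using assms by (simp add: p_def)
  \<comment> \<open>A nonzero index has \<open>N \<ge> 1\<close>, whence
    \<open>S = N + real d \<le> real (d + 1) * N\<close>. So
    \<open>\<rho> / real (d + 1) * S\<close> bounds the dot product from below, and \<open>C\<close>
    is the contribution of the prefactor.\<close>
  define C where "C = (\<rho> / real (d + 1)) powr (-s)"
  let ?G = "\<lambda>n. \<Prod>i\<in>{1..d}. (real (n i) + 1) powr (-p)"
  have "summable (\<lambda>k. real k powr (-p))" using p by (simp add: summable_real_powr_iff)
  hence "summable (\<lambda>k. norm ((real k + 1) powr (-p)))"
    by (subst (asm) summable_Suc_iff[symmetric]) (simp add: add.commute)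
  hence "(\<lambda>k. norm ((real k + 1) powr (-p))) summable_on UNIV"
    by (intro norm_summable_imp_summable_on) simp
  hence "(\<lambda>n. norm (?G n)) summable_on ({1..d} \<rightarrow>\<^sub>E UNIV)"
    unfolding abs_summable_equivalent
    by (intro abs_summable_on_prod_PiE) auto
  hence "?G summable_on ({1..d} \<rightarrow>\<^sub>E UNIV)" by (rule abs_summable_summable)
  hence "(\<lambda>n. C * ?G n) summable_on nonzero_indices d"
    by (intro summable_on_cmult_right) (rule summable_on_subset_banach, auto simp: nonzero_indices_def)
  thus ?thesis
  proof (rule summable_on_comparison_test)
    fix n assume n: "n \<in> nonzero_indices d"
    define N where "N = (\<Sum>i=1..d. real (n i))"
    have "N > 0" using dot_pos[OF n, of "\<lambda>_. 1"] by (simp add: N_def)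
    hence N: "N \<ge> 1" unfolding N_def by (simp flip: of_nat_sum)
    \<comment> \<open>Each factor \<open>n i + 1\<close> is at most \<open>S\<close>, so \<open>S powr (-s)\<close> is bounded by a product of
      one-dimensional summable terms, each with exponent \<open>- s / d < -1\<close>.\<close>
    define S where "S = (\<Sum>i=1..d. real (n i) + 1)"
    have S_eq: "S = N + real d" by (simp add: S_def N_def sum.distrib)
    have S: "S \<le> real (d + 1) * N" "S > 0"
      using N mult_left_mono[of 1 N "real d"] by (auto simp: S_eq algebra_simps)
    have "(\<Prod>i=1..d. real (n i) + 1) \<le> (\<Prod>i=1..d. S)"
      by (intro prod_mono) (auto simp: S_def intro!: member_le_sum)
    hence prod_le: "(\<Prod>i=1..d. real (n i) + 1) \<le> S powr real d"
      using S by (simp add: powr_realpow)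
    have "\<rho> / real (d + 1) * S \<le> \<rho> * N"
      using mult_left_mono[OF S(1), of "\<rho>"] \<rho> by (simp add: divide_le_eq mult_ac)
    also have "\<dots> \<le> (\<Sum>i=1..d. real (n i) * r i)"
      unfolding N_def sum_distrib_left
      by (intro sum_mono) (auto simp: mult.commute[of \<rho>] intro!: mult_left_mono \<rho>_le)
    finally have "(\<Sum>i=1..d. real (n i) * r i) powr (-s) \<le> (\<rho> / real (d + 1) * S) powr (-s)"
      using \<rho> S assms(3) by (intro powr_mono2') auto
    also have "\<dots> = C * (S powr real d) powr (-p)"
      using \<rho> S assms(1) unfolding C_def p_def by (subst powr_mult) (auto simp: powr_powr)
    also have "\<dots> \<le> C * (\<Prod>i=1..d. real (n i) + 1) powr (-p)"
      using p prod_le by (intro mult_left_mono powr_mono2' prod_pos) (auto simp: C_def)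
    also have "\<dots> = C * ?G n"
      by (subst prod_powr_distrib) auto
    finally show "(\<Sum>i=1..d. real (n i) * r i) powr (-s) \<le> C * ?G n" .
  qed auto
qed

definition bose_factor :: "nat \<Rightarrow> (nat \<Rightarrow> complex) \<Rightarrow> real \<Rightarrow> complex" where
  "bose_factor d w t = 1 / (\<Prod>i=1..d. 1 - exp (- w i * of_real t))"

lemma has_sum_bose_factor:
  assumes "\<And>i. i \<in> {1..d} \<Longrightarrow> Re (w i) > 0" "t > 0"
  defines "f \<equiv> \<lambda>n. exp (- (\<Sum>i=1..d. of_nat (n i) * w i) * of_real t)"
  shows "(f has_sum (bose_factor d w t - 1)) (nonzero_indices d)"
    and "(\<lambda>n. norm (f n)) summable_on nonzero_indices d"
proof -
  let ?q = "\<lambda>i. exp (- w i * of_real t)"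
  have q: "norm (?q i) < 1" if "i \<in> {1..d}" for i
    using assms(1)[OF that] assms(2) by simp
  have f_eq: "f n = (\<Prod>i\<in>{1..d}. ?q i ^ n i)" for n
  proof -
    have "- (\<Sum>i=1..d. of_nat (n i) * w i) * of_real t = (\<Sum>i=1..d. of_nat (n i) * (- w i * of_real t))"
      by (simp add: sum_distrib_right sum_negf mult.assoc)
    thus ?thesis by (simp only: f_def exp_sum finite_atLeastAtMost exp_of_nat_mult)
  qed
  have q_abs: "(\<lambda>k. norm (?q i ^ k)) summable_on UNIV" if "i \<in> {1..d}" for i
    using summable_geometric[of "norm (?q i)"] q[OF that]
    by (intro norm_summable_imp_summable_on) (simp add: norm_power)
  have abs: "(\<lambda>n. norm (f n)) summable_on ({1..d} \<rightarrow>\<^sub>E UNIV)"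
    unfolding f_eq abs_summable_equivalent
    by (intro abs_summable_on_prod_PiE q_abs[unfolded abs_summable_equivalent]) auto
  thus "(\<lambda>n. norm (f n)) summable_on nonzero_indices d"
    by (rule summable_on_subset_banach) (auto simp: nonzero_indices_def)
  have "infsum f ({1..d} \<rightarrow>\<^sub>E UNIV) = (\<Prod>i=1..d. \<Sum>\<^sub>\<infinity>k. ?q i ^ k)"
    unfolding f_eq by (intro infsum_prod_PiE_abs q_abs) auto
  also have "\<dots> = (\<Prod>i=1..d. 1 / (1 - ?q i))"
  proof (intro prod.cong refl infsumI)
    fix i assume i: "i \<in> {1..d}"
    show "((\<lambda>k. ?q i ^ k) has_sum 1 / (1 - ?q i)) UNIV"
      using q[OF i] geometric_sums[of "?q i"] summable_geometric[of "norm (?q i)"]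
      by (intro norm_summable_imp_has_sum) (auto simp: norm_power)
  qed
  also have "\<dots> = bose_factor d w t" by (simp add: bose_factor_def prod_dividef)
  finally have "(f has_sum bose_factor d w t) ({1..d} \<rightarrow>\<^sub>E UNIV)"
    using abs_summable_summable[OF abs] by (metis has_sum_infsum)
  \<comment> \<open>The zero multi-index contributes \<open>exp 0 = 1\<close>; removing it is the
    origin of the \<open>- 1\<close> in all integrands.\<close>
  moreover have "(f has_sum 1) {\<lambda>i\<in>{1..d}. 0}"
    by (rule has_sum_finiteI) (auto simp: f_eq)
  ultimately show "(f has_sum (bose_factor d w t - 1)) (nonzero_indices d)"
    unfolding nonzero_indices_def by (rule has_sum_Diff) auto
qed

lemma barnes_mellin:
  assumes "d \<ge> 1" and w_pos: "\<forall>i\<in>{1..d}. Re (w i) > 0" and \<alpha>: "Re \<alpha> > real d"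
  defines "g \<equiv> \<lambda>t. of_real t powr (\<alpha> - 1) * (bose_factor d w t - 1)"
  shows "barnes_term d w \<alpha> summable_on nonzero_indices d"
    and "set_integrable lborel {0<..} g"
    and "(LINT t:{0<..}|lborel. g t) = Gamma \<alpha> * barnes_series d w \<alpha>"
proof -
  note w = bspec[OF w_pos]
  let ?N = "nonzero_indices d"
  define a where "a = (\<lambda>n. \<Sum>i=1..d. of_nat (n i) * w i)"
  have Re_a: "Re (a n) = (\<Sum>i=1..d. real (n i) * Re (w i))" for n by (simp add: a_def)
  have a_pos: "Re (a n) > 0" if "n \<in> ?N" for n
    unfolding Re_a using that w by (rule dot_pos)
  have \<alpha>0: "Re \<alpha> > 0" using \<alpha> by simp
  define K where "K = Gamma (Re \<alpha>)"
  have sum_Re: "(\<lambda>n. Re (a n) powr (- Re \<alpha>)) summable_on ?N"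
    unfolding Re_a using assms by (intro summable_on_dot_powr) auto
  have term_eq: "barnes_term d w \<alpha> n = a n powr (-\<alpha>)" for n
    by (simp add: barnes_term_def a_def)
  have "(\<lambda>n. norm (barnes_term d w \<alpha> n)) summable_on ?N"
    using a_pos norm_powr_le_Re_powr[OF \<alpha>0] unfolding term_eq
    by (intro Infinite_Sum.abs_summable_on_comparison_test'[OF summable_on_cmult_right[OF sum_Re, of "K / norm (Gamma \<alpha>)"]])
       (auto simp: K_def)
  thus summ: "barnes_term d w \<alpha> summable_on ?N" by (rule abs_summable_summable)

  \<comment> \<open>Termwise integration is applied to a series over the naturals, so the
    multi-indices are enumerated; absolute convergence makes the order irrelevant.\<close>
  obtain e where e: "bij_betw e (UNIV :: nat set) ?N"
    using bij_betw_from_nat_into countable_infinite_nonzero_indices[OF assms(1)] by blast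
  hence eN: "e k \<in> ?N" for k by (auto simp: bij_betw_def)
  define F where "F = (\<lambda>k t. indicator {0<..} t *\<^sub>R gamma_kernel \<alpha> (a (e k)) t)"
  have F_int: "integrable lborel (F k)" for k
    using gamma_kernel_integrable[OF \<alpha>0 a_pos[OF eN[of k]]] unfolding set_integrable_def F_def .
  have F_eq: "F k t = of_real t powr (\<alpha> - 1) * exp (- a (e k) * of_real t)" if "t > 0" for k t
    using that by (simp add: F_def gamma_kernel_def)
  have F_summable: "summable (\<lambda>k. norm (F k t))" for t
  proof (cases "t > 0")
    case True
    have "(\<lambda>n. norm (exp (- a n * of_real t))) summable_on ?N"
      using has_sum_bose_factor(2)[OF w True] by (simp add: a_def)
    hence "(\<lambda>k. norm (exp (- a (e k) * of_real t))) summable_on UNIV"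
      by (subst summable_on_reindex_bij_betw[OF e])
    hence "summable (\<lambda>k. norm (exp (- a (e k) * of_real t)))" by (rule summable_on_imp_summable)
    thus ?thesis using True by (simp only: F_eq norm_mult) (rule summable_mult)
  qed (simp add: F_def)
  have F_suminf: "(\<Sum>k. F k t) = indicator {0<..} t *\<^sub>R g t" for t
  proof (cases "t > 0")
    case True
    have "((\<lambda>n. exp (- a n * of_real t)) has_sum (bose_factor d w t - 1)) ?N"
      using has_sum_bose_factor(1)[OF w True] by (simp add: a_def)
    hence "((\<lambda>k. exp (- a (e k) * of_real t)) has_sum (bose_factor d w t - 1)) UNIV"
      by (subst has_sum_reindex_bij_betw[OF e])
    hence "(\<lambda>k. exp (- a (e k) * of_real t)) sums (bose_factor d w t - 1)" by (rule has_sum_imp_sums)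
    hence "(\<lambda>k. F k t) sums g t"
      unfolding F_eq[OF True] g_def by (rule sums_mult)
    thus ?thesis using True by (simp add: sums_iff)
  qed (simp add: F_def)
  \<comment> \<open>This licenses the exchange of sum and integral. The integrals of the norms are
    exactly \<open>K * Re (a (e k)) powr (- Re \<alpha>)\<close>, and their convergence is where
    \<open>Re \<alpha> > real d\<close> enters.\<close>
  have norm_sum: "summable (\<lambda>k. \<integral>t. norm (F k t) \<partial>lborel)"
  proof -
    have "(\<lambda>k. Re (a (e k)) powr (- Re \<alpha>)) summable_on UNIV"
      using sum_Re by (subst summable_on_reindex_bij_betw[OF e])
    hence "summable (\<lambda>k. K * Re (a (e k)) powr (- Re \<alpha>))"
      by (intro summable_mult summable_on_imp_summable)
    thus ?thesis
      unfolding F_def K_def by (simp only: integral_norm_gamma_kernel[OF \<alpha>0 a_pos[OF eN]])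
  qed
  note facts = F_int AE_I2[OF F_summable] norm_sum
  from integrable_suminf[OF facts] show "set_integrable lborel {0<..} g"
    by (simp add: F_suminf set_integrable_def)
  from sums_integral[OF facts]
  have "(\<lambda>k. \<integral>t. F k t \<partial>lborel) sums (LINT t:{0<..}|lborel. g t)"
    by (simp add: F_suminf set_lebesgue_integral_def)
  moreover have "(\<integral>t. F k t \<partial>lborel) = Gamma \<alpha> * a (e k) powr (-\<alpha>)" for k
    using gamma_kernel_integral[OF \<alpha>0 a_pos[OF eN[of k]]] by (simp add: F_def set_lebesgue_integral_def)
  ultimately have "(\<lambda>k. Gamma \<alpha> * a (e k) powr (-\<alpha>)) sums (LINT t:{0<..}|lborel. g t)" by simp
  moreover have "(\<lambda>k. Gamma \<alpha> * a (e k) powr (-\<alpha>)) sums (Gamma \<alpha> * barnes_series d w \<alpha>)"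
  proof (intro sums_mult has_sum_imp_sums)
    have "((\<lambda>n. a n powr (-\<alpha>)) has_sum barnes_series d w \<alpha>) ?N"
      using summ unfolding barnes_series_def term_eq by (rule has_sum_infsum)
    thus "((\<lambda>k. a (e k) powr (-\<alpha>)) has_sum barnes_series d w \<alpha>) UNIV"
      by (subst has_sum_reindex_bij_betw[OF e])
  qed
  ultimately show "(LINT t:{0<..}|lborel. g t) = Gamma \<alpha> * barnes_series d w \<alpha>"
    by (rule sums_unique2)
qed

section \<open>The regularised integral\<close>

text \<open>Convergence at the single radius \<open>\<rho> = R / 2\<close> bounds the coefficients
  by \<open>K / \<rho> ^ n\<close>. For \<open>norm z < \<rho> / 2\<close> the tail is then
  dominated by a geometric series of ratio \<open>1 / 2\<close>, whose sum is the factor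
  \<open>2\<close>. The point \<open>0\<close> is left out because the Bernoulli generating function
  has a removable singularity there.\<close>

lemma power_series_remainder_bound:
  fixes a :: "nat \<Rightarrow> complex"
  assumes "R > 0" and sums: "\<And>z. z \<noteq> 0 \<Longrightarrow> norm z < R \<Longrightarrow> (\<lambda>n. a n * z ^ n) sums G z"
  shows "\<exists>\<epsilon>>0. \<exists>C\<ge>0. \<forall>z. z \<noteq> 0 \<and> norm z < \<epsilon> \<longrightarrow>
           norm (G z - (\<Sum>k\<le>M. a k * z ^ k)) \<le> C * norm z ^ (M + 1)"
proof -
  define \<rho> where "\<rho> = R / 2"
  have \<rho>: "\<rho> > 0" "\<rho> < R" using assms(1) by (auto simp: \<rho>_def)
  have "summable (\<lambda>n. a n * of_real \<rho> ^ n)"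
    using sums[of "of_real \<rho>"] \<rho> by (auto simp: sums_iff)
  hence "Bseq (\<lambda>n. a n * of_real \<rho> ^ n)"
    by (intro convergent_imp_Bseq) (auto dest: summable_LIMSEQ_zero simp: convergent_def)
  then obtain K where K: "K > 0" "\<And>n. norm (a n * of_real \<rho> ^ n) \<le> K"
    by (auto elim: BseqE)
  have a_le: "norm (a n) \<le> K / \<rho> ^ n" for n
    using K(2)[of n] \<rho> by (simp add: norm_mult norm_power field_simps)
  have "norm (G z - (\<Sum>k\<le>M. a k * z ^ k)) \<le> 2 * K / \<rho> ^ (M + 1) * norm z ^ (M + 1)"
    if z: "z \<noteq> 0" "norm z < \<rho> / 2" for z
  proof (rule norm_sums_le)
    show "(\<lambda>n. a (n + Suc M) * z ^ (n + Suc M)) sums (G z - (\<Sum>k\<le>M. a k * z ^ k))"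
      using sums_split_initial_segment[OF sums[of z], of "Suc M"] z \<rho>
      by (simp add: lessThan_Suc_atMost)
    have "(\<lambda>n. K / \<rho> ^ (M + 1) * norm z ^ (M + 1) * (1 / 2) ^ n) sums
            (K / \<rho> ^ (M + 1) * norm z ^ (M + 1) * 2)"
      using geometric_sums[of "1 / 2 :: real"] by (intro sums_mult) simp
    thus "(\<lambda>n. K / \<rho> ^ (M + 1) * norm z ^ (M + 1) * (1 / 2) ^ n) sums
            (2 * K / \<rho> ^ (M + 1) * norm z ^ (M + 1))"
      by (simp add: mult_ac)
    fix n
    have "norm (a (n + Suc M) * z ^ (n + Suc M)) \<le> K / \<rho> ^ (n + Suc M) * norm z ^ (n + Suc M)"
      by (simp only: norm_mult norm_power mult_right_mono[OF a_le] zero_le_power norm_ge_zero)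
    also have "\<dots> = K / \<rho> ^ (M + 1) * norm z ^ (M + 1) * (norm z / \<rho>) ^ n"
      by (simp add: power_add power_divide mult_ac)
    also have "\<dots> \<le> K / \<rho> ^ (M + 1) * norm z ^ (M + 1) * (1 / 2) ^ n"
      using z \<rho> K(1) by (intro mult_left_mono power_mono) (auto simp: field_simps)
    finally show "norm (a (n + Suc M) * z ^ (n + Suc M)) \<le>
        K / \<rho> ^ (M + 1) * norm z ^ (M + 1) * (1 / 2) ^ n" .
  qed
  moreover have "\<rho> / 2 > 0" "2 * K / \<rho> ^ (M + 1) \<ge> 0" using \<rho> K by auto
  ultimately show ?thesis by blast
qed

context
  fixes d :: nat and w :: "nat \<Rightarrow> complex" and c :: complex
  assumes d: "d \<ge> 1" and w: "\<forall>i\<in>{1..d}. Re (w i) > 0" and c: "Re c > 0"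
begin

text \<open>Separated from the integrand because it does not depend on \<alpha>: a change of
  \<alpha> merely multiplies the integrand by a power of \<open>t\<close>, which carries
  measurability and domination from one \<alpha> to another.\<close>

definition barnes_remainder :: "nat \<Rightarrow> real \<Rightarrow> complex" where
  "barnes_remainder M t = 
     (bose_factor d w t - 1
      - exp (- c * of_real t) / (of_real t ^ d * (\<Prod>i=1..d. w i)) *
          (\<Sum>k\<le>M. (-1) ^ k * barnes_bernoulli k d w (-c) * of_real t ^ k / fact k)
      + exp (- c * of_real t) * (\<Sum>k | k + d \<le> M. (c * of_real t) ^ k / fact k))"

lemma barnes_J_integrand_eq:
  "barnes_J_integrand d w M c \<alpha> t = of_real t powr (\<alpha> - 1) * barnes_remainder M t"
  by (simp add: barnes_J_integrand_def barnes_remainder_def bose_factor_def)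

text \<open>\<open>bose_factor d w t\<close> is
  \<open>exp (- c * t) / (t ^ d * (\<Prod>i=1..d. w i))\<close> times the Bernoulli generating
  function for \<open>x = -c\<close> at \<open>z = -t\<close>: the factor
  \<open>exp (x * z) = exp (c * t)\<close> cancels the damping, and the sign of \<open>z\<close>
  gives \<open>(-1) ^ k\<close>. Dividing a remainder of order \<open>M + 1\<close> by
  \<open>t ^ d\<close> yields the exponent.\<close>

lemma bose_factor_remainder_bound:
  "\<exists>\<epsilon>>0. \<exists>C\<ge>0. \<forall>t. 0 < t \<and> t < \<epsilon> \<longrightarrow>
     norm (bose_factor d w t - exp (- c * of_real t) / (of_real t ^ d * (\<Prod>i=1..d. w i)) *
          (\<Sum>k\<le>M. (-1) ^ k * barnes_bernoulli k d w (-c) * of_real t ^ k / fact k))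
       \<le> C * t powr (real M + 1 - real d)"
proof -
  let ?W = "\<Prod>i=1..d. w i"
  have w_nz: "w i \<noteq> 0" if "i \<in> {1..d}" for i using bspec[OF w that] by auto
  hence W: "?W \<noteq> 0" by auto
  define R where "R = 2 * pi / (MAX i\<in>{1..d}. norm (w i))"
  have "norm (w 1) \<le> (MAX i\<in>{1..d}. norm (w i))" "norm (w 1) > 0"
    using d w_nz[of 1] by (auto intro!: Max_ge)
  hence "(MAX i\<in>{1..d}. norm (w i)) > 0" by linarith
  hence R: "R > 0" unfolding R_def by (intro divide_pos_pos) auto
  define G where "G = (\<lambda>z. z ^ d * exp (- c * z) * (\<Prod>i=1..d. w i / (exp (w i * z) - 1)))"
  define a where "a = (\<lambda>k. barnes_bernoulli k d w (-c) / fact k)"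
  have "(\<lambda>n. a n * z ^ n) sums G z" if "z \<noteq> 0" "norm z < R" for z
    using bernoulli_coeffs_barnes_bernoulli[OF d w_nz, where x = "-c"] that
    unfolding bernoulli_coeffs_def R_def a_def G_def by simp
  from power_series_remainder_bound[OF R this, of M] obtain \<epsilon> C where
    C: "\<epsilon> > 0" "C \<ge> 0" "\<And>z. z \<noteq> 0 \<Longrightarrow> norm z < \<epsilon> \<Longrightarrow>
           norm (G z - (\<Sum>k\<le>M. a k * z ^ k)) \<le> C * norm z ^ (M + 1)"
    by blast
  have "norm (bose_factor d w t - exp (- c * of_real t) / (of_real t ^ d * ?W) *
          (\<Sum>k\<le>M. (-1) ^ k * barnes_bernoulli k d w (-c) * of_real t ^ k / fact k))
       \<le> C / norm ?W * t powr (real M + 1 - real d)" (is "norm ?x \<le> _") if t: "0 < t" "t < \<epsilon>" for t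
  proof -
    let ?z = "- complex_of_real t"
    have "(\<Sum>k\<le>M. (-1) ^ k * barnes_bernoulli k d w (-c) * of_real t ^ k / fact k) =
          (\<Sum>k\<le>M. a k * ?z ^ k)"
      by (intro sum.cong) (auto simp: a_def power_minus[of "of_real t"])
    moreover have "bose_factor d w t = exp (- c * of_real t) / (of_real t ^ d * ?W) * G ?z"
    proof -
      have "?z ^ d * (\<Prod>i=1..d. w i / (exp (w i * ?z) - 1)) =
              (\<Prod>i=1..d. ?z * (w i / (exp (w i * ?z) - 1)))"
        by (simp only: prod.distrib prod_constant) simp
      also have "\<dots> = (\<Prod>i=1..d. of_real t * w i / (1 - exp (- w i * of_real t)))"
        by (intro prod.cong refl) (simp add: minus_divide_right)
      also have "\<dots> = of_real t ^ d * ?W * bose_factor d w t"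
        by (simp add: bose_factor_def prod_dividef prod.distrib)
      finally have "G ?z = exp (c * of_real t) * (of_real t ^ d * ?W * bose_factor d w t)"
        by (simp add: G_def mult_ac)
      thus ?thesis using W t by (simp add: exp_minus)
    qed
    ultimately have "?x = exp (- c * of_real t) / (of_real t ^ d * ?W) * (G ?z - (\<Sum>k\<le>M. a k * ?z ^ k))"
      by (simp only: right_diff_distrib)
    also have "norm \<dots> \<le> 1 / (t ^ d * norm ?W) * (C * t ^ (M + 1))"
      unfolding norm_mult norm_divide
    proof (intro mult_mono frac_le)
      show "norm (G ?z - (\<Sum>k\<le>M. a k * ?z ^ k)) \<le> C * t ^ (M + 1)"
        using C(3)[of ?z] t by simp
    qed (use t c W C in \<open>auto simp: norm_power\<close>)
    also have "\<dots> = C / norm ?W * (t powr real (M + 1) / t powr real d)"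
      using t by (simp only: powr_realpow) simp
    also have "\<dots> = C / norm ?W * t powr (real M + 1 - real d)"
      by (simp add: powr_diff add.commute)
    finally show ?thesis .
  qed
  moreover have "C / norm ?W \<ge> 0" using C by simp
  ultimately show ?thesis using C(1) by blast
qed

text \<open>This controls the \<open>1\<close> of the removed zero index. For
  \<open>d \<le> M\<close> it is Taylor's formula for \<open>exp (c * t)\<close> up to degree
  \<open>M - d\<close>, multiplied by the damping. For \<open>M < d\<close> the sum is empty, but
  the exponent is at most \<open>0\<close>, so the constant \<open>1\<close> is already within the
  bound when \<open>t < 1\<close>.\<close>

lemma exp_remainder_bound:
  "\<exists>\<epsilon>>0. \<exists>C\<ge>0. \<forall>t. 0 < t \<and> t < \<epsilon> \<longrightarrow>
     norm (1 - exp (- c * of_real t) * (\<Sum>k | k + d \<le> M. (c * of_real t) ^ k / fact k))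
       \<le> C * t powr (real M + 1 - real d)"
proof (cases "d \<le> M")
  case False
  hence "{k. k + d \<le> M} = {}" by auto
  moreover have "1 \<le> t powr (real M + 1 - real d)" if "0 < t" "t < 1" for t
    using that False powr_mono'[of "real M + 1 - real d" 0 t] by simp
  ultimately show ?thesis by (intro exI[of _ 1] conjI) auto
next
  case True
  define N where "N = M - d"
  have N: "{k. k + d \<le> M} = {..N}" "real M + 1 - real d = real (N + 1)" using True by (auto simp: N_def)
  define a where "a = (\<lambda>k. c ^ k / fact k)"
  have "(\<lambda>n. a n * z ^ n) sums exp (c * z)" for z
    using exp_converges[of "c * z"] by (simp add: a_def power_mult_distrib scaleR_conv_of_real field_simps)
  from power_series_remainder_bound[OF zero_less_one this, of N] obtain \<epsilon> C where
    C: "\<epsilon> > 0" "C \<ge> 0" "\<And>z. z \<noteq> 0 \<Longrightarrow> norm z < \<epsilon> \<Longrightarrow>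
           norm (exp (c * z) - (\<Sum>k\<le>N. a k * z ^ k)) \<le> C * norm z ^ (N + 1)"
    by blast
  have "norm (1 - exp (- c * of_real t) * (\<Sum>k\<le>N. (c * of_real t) ^ k / fact k)) \<le>
          C * t powr real (N + 1)" if t: "0 < t" "t < \<epsilon>" for t
  proof -
    have "1 - exp (- c * of_real t) * (\<Sum>k\<le>N. (c * of_real t) ^ k / fact k) =
      exp (- c * of_real t) * (exp (c * of_real t) - (\<Sum>k\<le>N. a k * of_real t ^ k))"
      by (simp add: a_def right_diff_distrib power_mult_distrib flip: exp_add)
    also have "norm \<dots> \<le> 1 * (C * t ^ (N + 1))"
      unfolding norm_mult
    proof (intro mult_mono)
      show "norm (exp (c * of_real t) - (\<Sum>k\<le>N. a k * of_real t ^ k)) \<le> C * t ^ (N + 1)"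
        using C(3)[of "of_real t"] t by simp
    qed (use t c in auto)
    finally show ?thesis using t by (simp only: powr_realpow mult_1)
  qed
  thus ?thesis using C(1,2) unfolding N by blast
qed

lemma barnes_remainder_bound:
  "\<exists>\<epsilon>>0. \<exists>C\<ge>0. \<epsilon> \<le> 1 \<and> (\<forall>t. 0 < t \<and> t < \<epsilon> \<longrightarrow>
     norm (barnes_remainder M t) \<le> C * t powr (real M + 1 - real d))"
proof -
  obtain \<epsilon>1 C1 where 1: "\<epsilon>1 > 0" "C1 \<ge> 0" "\<And>t. 0 < t \<Longrightarrow> t < \<epsilon>1 \<Longrightarrow>
     norm (bose_factor d w t - exp (- c * of_real t) / (of_real t ^ d * (\<Prod>i=1..d. w i)) *
          (\<Sum>k\<le>M. (-1) ^ k * barnes_bernoulli k d w (-c) * of_real t ^ k / fact k))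
       \<le> C1 * t powr (real M + 1 - real d)"
    using bose_factor_remainder_bound[of M] by blast
  obtain \<epsilon>2 C2 where 2: "\<epsilon>2 > 0" "C2 \<ge> 0" "\<And>t. 0 < t \<Longrightarrow> t < \<epsilon>2 \<Longrightarrow>
     norm (1 - exp (- c * of_real t) * (\<Sum>k | k + d \<le> M. (c * of_real t) ^ k / fact k))
       \<le> C2 * t powr (real M + 1 - real d)"
    using exp_remainder_bound[of M] by blast
  \<comment> \<open>The cap at \<open>1\<close> lets the later domination compare powers of
    \<open>t\<close> and of \<open>\<epsilon>\<close> by their exponents.\<close>
  have "norm (barnes_remainder M t) \<le> (C1 + C2) * t powr (real M + 1 - real d)"
    if t: "0 < t" "t < min 1 (min \<epsilon>1 \<epsilon>2)" for t
  proof -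
    have eq: "x - 1 - y + v = (x - y) - (1 - v)" for x y v :: complex by simp
    show ?thesis
      unfolding barnes_remainder_def eq distrib_right
      using t by (intro order.trans[OF norm_triangle_ineq4] add_mono 1(3) 2(3)) auto
  qed
  moreover have "min 1 (min \<epsilon>1 \<epsilon>2) > 0" "C1 + C2 \<ge> 0" using 1 2 by auto
  ultimately show ?thesis by (intro exI[of _ "min 1 (min \<epsilon>1 \<epsilon>2)"]) auto
qed

lemma barnes_J_integrand_eq_kernels:
  assumes "t > 0"
  shows "barnes_J_integrand d w M c \<alpha> t =
    of_real t powr (\<alpha> - 1) * (bose_factor d w t - 1)
    - (\<Sum>k\<le>M. (-1) ^ k * barnes_bernoulli k d w (-c) / fact k / (\<Prod>i=1..d. w i) *
         gamma_kernel (\<alpha> - of_nat d + of_nat k) c t)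
    + (\<Sum>k | k + d \<le> M. c ^ k / fact k * gamma_kernel (\<alpha> + of_nat k) c t)"
proof -
  have 1: "of_real t powr (\<alpha> - 1) * (exp (- c * of_real t) / (of_real t ^ d * W) *
          ((-1) ^ k * b * of_real t ^ k / fact k)) =
        (-1) ^ k * b / fact k / W * gamma_kernel (\<alpha> - of_nat d + of_nat k) c t" for W b k
  proof -
    have "complex_of_real t powr (\<alpha> - of_nat d + of_nat k - 1) =
            of_real t powr (\<alpha> - 1) * of_real t ^ k / of_real t ^ d"
    proof -
      have "\<alpha> - of_nat d + of_nat k - 1 = \<alpha> - 1 + of_nat k - of_nat d" by simp
      thus ?thesis using assms by (simp only: powr_diff powr_add) (simp add: powr_diff)
    qed
    thus ?thesis by (simp add: gamma_kernel_def mult_ac)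
  qed
  have 2: "of_real t powr (\<alpha> - 1) * (exp (- c * of_real t) * ((c * of_real t) ^ k / fact k)) =
        c ^ k / fact k * gamma_kernel (\<alpha> + of_nat k) c t" for k
  proof -
    have "complex_of_real t powr (\<alpha> + of_nat k - 1) = of_real t powr (\<alpha> - 1) * of_real t ^ k"
    proof -
      have "\<alpha> + of_nat k - 1 = \<alpha> - 1 + of_nat k" by simp
      thus ?thesis using assms by (simp only: powr_add) simp
    qed
    thus ?thesis by (simp add: gamma_kernel_def power_mult_distrib)
  qed
  show ?thesis
    unfolding barnes_J_integrand_eq barnes_remainder_def ring_distribs right_diff_distrib
      sum_distrib_left 1 2 by simp
qed

text \<open>For \<open>Re \<alpha> > real d\<close> even the most singular kernel,
  \<open>k = 0\<close> with parameter \<open>\<alpha> - of_nat d\<close>, is integrable, so the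
  parts may be integrated one by one.\<close>

lemma barnes_J_integral_right:
  assumes \<alpha>: "Re \<alpha> > real d"
  shows "set_integrable lborel {0<..} (barnes_J_integrand d w M c \<alpha>)"
    and "(LINT t:{0<..}|lborel. barnes_J_integrand d w M c \<alpha> t) =
      Gamma \<alpha> * barnes_series d w \<alpha>
    - (\<Sum>k\<le>M. (-1) ^ k * barnes_bernoulli k d w (-c) / fact k / (\<Prod>i=1..d. w i) *
         (Gamma (\<alpha> - of_nat d + of_nat k) * c powr (- (\<alpha> - of_nat d + of_nat k))))
    + (\<Sum>k | k + d \<le> M. c ^ k / fact k * (Gamma (\<alpha> + of_nat k) * c powr (- (\<alpha> + of_nat k))))"
proof -
  let ?I = "\<lambda>t::real. indicator {0<..} t :: real"
  let ?b = "\<lambda>k. (-1) ^ k * barnes_bernoulli k d w (-c) / fact k / (\<Prod>i=1..d. w i)"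
  define f1 where "f1 = (\<lambda>t. ?I t *\<^sub>R (of_real t powr (\<alpha> - 1) * (bose_factor d w t - 1)))"
  define f2 where "f2 = (\<lambda>k t. ?I t *\<^sub>R gamma_kernel (\<alpha> - of_nat d + of_nat k) c t)"
  define f3 where "f3 = (\<lambda>k t. ?I t *\<^sub>R gamma_kernel (\<alpha> + of_nat k) c t)"
  have fin: "finite {k. k + d \<le> M}" by (rule finite_subset[of _ "{..M}"]) auto
  have eq: "?I t *\<^sub>R barnes_J_integrand d w M c \<alpha> t =
      f1 t - (\<Sum>k\<le>M. ?b k * f2 k t) + (\<Sum>k | k + d \<le> M. c ^ k / fact k * f3 k t)" for t
    using barnes_J_integrand_eq_kernels[of t M \<alpha>]
    by (cases "t > 0") (simp_all add: f1_def f2_def f3_def)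
  note mellin = barnes_mellin[OF d w \<alpha>]
  have f1: "integrable lborel f1" "integral\<^sup>L lborel f1 = Gamma \<alpha> * barnes_series d w \<alpha>"
    using mellin(2,3) by (simp_all add: f1_def set_integrable_def set_lebesgue_integral_def)
  have f2: "integrable lborel (f2 k)"
    "integral\<^sup>L lborel (f2 k) = Gamma (\<alpha> - of_nat d + of_nat k) * c powr (- (\<alpha> - of_nat d + of_nat k))" for k
    using gamma_kernel_integrable[of "\<alpha> - of_nat d + of_nat k" c]
      gamma_kernel_integral[of "\<alpha> - of_nat d + of_nat k" c] \<alpha> c
    by (simp_all add: f2_def set_integrable_def set_lebesgue_integral_def)
  have f3: "integrable lborel (f3 k)"
    "integral\<^sup>L lborel (f3 k) = Gamma (\<alpha> + of_nat k) * c powr (- (\<alpha> + of_nat k))" for k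
    using gamma_kernel_integrable[of "\<alpha> + of_nat k" c]
      gamma_kernel_integral[of "\<alpha> + of_nat k" c] \<alpha> c
    by (simp_all add: f3_def set_integrable_def set_lebesgue_integral_def)
  show "set_integrable lborel {0<..} (barnes_J_integrand d w M c \<alpha>)"
    unfolding set_integrable_def eq using f1(1) f2(1) f3(1) by simp
  show "(LINT t:{0<..}|lborel. barnes_J_integrand d w M c \<alpha> t) =
      Gamma \<alpha> * barnes_series d w \<alpha>
    - (\<Sum>k\<le>M. ?b k *
         (Gamma (\<alpha> - of_nat d + of_nat k) * c powr (- (\<alpha> - of_nat d + of_nat k))))
    + (\<Sum>k | k + d \<le> M. c ^ k / fact k * (Gamma (\<alpha> + of_nat k) * c powr (- (\<alpha> + of_nat k))))"
    unfolding set_lebesgue_integral_def eq using f1 f2 f3 by simp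
qed

text \<open>At \<open>\<beta> = d + 1\<close> measurability comes with integrability; any other
  \<alpha> differs by the continuous factor \<open>t powr (\<alpha> - \<beta>)\<close> on the open
  half-line.\<close>

lemma barnes_J_integrand_measurable:
  "(\<lambda>t. indicator {0<..} t *\<^sub>R barnes_J_integrand d w M c \<alpha> t) \<in> borel_measurable lborel"
proof -
  define \<beta> where "\<beta> = complex_of_real (real d + 1)"
  have "(\<lambda>t. indicator {0<..} t *\<^sub>R barnes_J_integrand d w M c \<beta> t) \<in> borel_measurable lborel"
    using barnes_J_integral_right(1)[of \<beta> M]
    unfolding set_integrable_def \<beta>_def by (intro borel_measurable_integrable) auto
  moreover have "(\<lambda>t. indicator {0<..} t *\<^sub>R (of_real t powr (\<alpha> - \<beta>) :: complex)) \<in> borel_measurable lborel"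
    unfolding measurable_lborel2
    by (intro borel_measurable_continuous_on_indicator continuous_intros) auto
  ultimately have "(\<lambda>t. (indicator {0<..} t *\<^sub>R (of_real t powr (\<alpha> - \<beta>) :: complex)) *
      (indicator {0<..} t *\<^sub>R barnes_J_integrand d w M c \<beta> t)) \<in> borel_measurable lborel"
    by (rule borel_measurable_times[rotated])
  also have "(\<lambda>t. (indicator {0<..} t *\<^sub>R (of_real t powr (\<alpha> - \<beta>) :: complex)) *
      (indicator {0<..} t *\<^sub>R barnes_J_integrand d w M c \<beta> t)) =
      (\<lambda>t. indicator {0<..} t *\<^sub>R barnes_J_integrand d w M c \<alpha> t)"
    by (auto simp: fun_eq_iff indicator_def barnes_J_integrand_eq powr_diff)
  finally show ?thesis .
qed

text \<open>
  Away from \<open>0\<close> no decay estimate is needed: the integrand at the real point \<open>a2 > d\<close>, whose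
  integrability comes from the Mellin representation, dominates the one at \<open>\<alpha>\<close>.
\<close>

lemma barnes_J_integrand_dominated:
  assumes a1: "a1 > real d - real M - 1" and a2: "a2 > real d"
  shows "\<exists>g. integrable lborel g \<and> (\<forall>\<alpha> t. a1 \<le> Re \<alpha> \<and> Re \<alpha> \<le> a2 \<longrightarrow>
           norm (indicator {0<..} t *\<^sub>R barnes_J_integrand d w M c \<alpha> t) \<le> g t)"
proof -
  obtain \<epsilon> C where C: "\<epsilon> > 0" "C \<ge> 0" "\<epsilon> \<le> 1" "\<And>t. 0 < t \<Longrightarrow> t < \<epsilon> \<Longrightarrow>
      norm (barnes_remainder M t) \<le> C * t powr (real M + 1 - real d)"
    using barnes_remainder_bound[of M] by blast
  \<comment> \<open>\<open>t powr (Re s - 1)\<close> is the worst power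
    \<open>t powr (a1 + real M - real d)\<close> near \<open>0\<close>, and \<open>Re s > 0\<close>
    is the hypothesis on \<open>a1\<close>. The factor \<open>exp 1\<close> in \<open>g1\<close>
    pays for the decay of \<open>gamma_kernel s 1\<close>, as \<open>exp (1 - t) \<ge> 1\<close> for
    \<open>t < \<epsilon> \<le> 1\<close>.\<close>
  define s where "s = complex_of_real (a1 + real M - real d + 1)"
  define g1 where "g1 = (\<lambda>t. C * exp 1 * norm (indicator {0<..} t *\<^sub>R gamma_kernel s 1 t))"
  \<comment> \<open>For \<open>t \<ge> \<epsilon>\<close> the norms at \<alpha> and at
    \<open>a2\<close> differ by the factor \<open>t powr (Re \<alpha> - a2)\<close>. Its exponent is
    at most \<open>0\<close>, so it is largest at \<open>t = \<epsilon>\<close>, and then, since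
    \<open>\<epsilon> \<le> 1\<close>, at \<open>Re \<alpha> = a1\<close>.\<close>
  define g2 where "g2 = (\<lambda>t. \<epsilon> powr (a1 - a2) *
     norm (indicator {0<..} t *\<^sub>R barnes_J_integrand d w M c (of_real a2) t))"
  have "Re s > 0" using a1 by (simp add: s_def)
  hence "integrable lborel g1"
    unfolding g1_def using gamma_kernel_integrable[of s 1]
    by (intro integrable_mult_right integrable_norm) (simp add: set_integrable_def)
  moreover have "integrable lborel g2"
    unfolding g2_def using barnes_J_integral_right(1)[of "of_real a2" M] a2
    by (intro integrable_mult_right integrable_norm) (simp add: set_integrable_def)
  ultimately have "integrable lborel (\<lambda>t. g1 t + g2 t)" by (rule Bochner_Integration.integrable_add)
  moreover have "norm (indicator {0<..} t *\<^sub>R barnes_J_integrand d w M c \<alpha> t) \<le> g1 t + g2 t"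
    if \<alpha>: "a1 \<le> Re \<alpha>" "Re \<alpha> \<le> a2" for \<alpha> t
  proof -
    have nonneg: "g1 t \<ge> 0" "g2 t \<ge> 0" using C by (simp_all add: g1_def g2_def)
    consider "t \<le> 0" | "0 < t" "t < \<epsilon>" | "t \<ge> \<epsilon>" "t > 0" by linarith
    thus ?thesis
    proof cases
      case 2
      have "norm (barnes_J_integrand d w M c \<alpha> t) \<le> t powr (Re \<alpha> - 1) * (C * t powr (real M + 1 - real d))"
        using 2 C(4)[OF 2]
        by (simp add: barnes_J_integrand_eq norm_mult norm_powr_real_powr mult_left_mono)
      also have "\<dots> = C * t powr (Re \<alpha> + real M - real d)"
        using 2 by (simp add: mult.left_commute[of _ C] flip: powr_add) (simp add: algebra_simps)
      also have "\<dots> \<le> C * t powr (a1 + real M - real d)"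
        using 2 C \<alpha> by (intro mult_left_mono powr_mono') auto
      also have "\<dots> \<le> C * (exp (1 - t) * t powr (a1 + real M - real d))"
        using 2 C by (intro mult_left_mono mult_right_mono[of 1, simplified]) auto
      also have "\<dots> = g1 t"
        using 2 by (simp add: g1_def norm_gamma_kernel s_def exp_diff exp_minus field_simps)
      finally show ?thesis using 2 nonneg by simp
    next
      case 3
      have "norm (barnes_J_integrand d w M c \<alpha> t) =
          t powr (Re \<alpha> - a2) * norm (barnes_J_integrand d w M c (of_real a2) t)"
        using 3 by (simp add: barnes_J_integrand_eq norm_mult norm_powr_real_powr flip: powr_add)
      also have "\<dots> \<le> \<epsilon> powr (a1 - a2) * norm (barnes_J_integrand d w M c (of_real a2) t)"
      proof (intro mult_right_mono)
        have "t powr (Re \<alpha> - a2) \<le> \<epsilon> powr (Re \<alpha> - a2)"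
          using 3 C \<alpha> by (intro powr_mono2') auto
        also have "\<dots> \<le> \<epsilon> powr (a1 - a2)"
          using C \<alpha> by (intro powr_mono') auto
        finally show "t powr (Re \<alpha> - a2) \<le> \<epsilon> powr (a1 - a2)" .
      qed auto
      also have "\<dots> = g2 t" using 3 by (simp add: g2_def)
      finally show ?thesis using 3 nonneg by simp
    qed (use nonneg in auto)
  qed
  ultimately show ?thesis by blast
qed

lemma barnes_J_integrand_integrable:
  assumes "Re \<alpha> > real d - real M - 1"
  shows "set_integrable lborel {0<..} (barnes_J_integrand d w M c \<alpha>)"
proof -
  have "max (Re \<alpha>) (real d + 1) > real d" by simp
  from barnes_J_integrand_dominated[OF assms this] obtain g where
    "integrable lborel g" "\<And>t. norm (indicator {0<..} t *\<^sub>R barnes_J_integrand d w M c \<alpha> t) \<le> g t"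
    by (metis max.cobounded1 order.refl)
  thus ?thesis
    unfolding set_integrable_def
    by (elim Bochner_Integration.integrable_bound)
       (use barnes_J_integrand_measurable in \<open>auto intro!: AE_I2 intro: order.trans[OF _ abs_ge_self]\<close>)
qed

lemma holomorphic_barnes_J:
  "barnes_J d w M c holomorphic_on {\<alpha>. Re \<alpha> > real d - real M - 1}"
proof -
  let ?S = "{\<alpha>. Re \<alpha> > real d - real M - 1}"
  have "(\<lambda>\<alpha>. \<integral>t. indicator {0<..} t *\<^sub>R barnes_J_integrand d w M c \<alpha> t \<partial>lborel) holomorphic_on ?S"
  proof (rule holomorphic_integral_dominated)
    show "open ?S" by (rule open_halfspace_Re_gt)
    show "(\<lambda>\<alpha>. indicator {0<..} t *\<^sub>R barnes_J_integrand d w M c \<alpha> t) holomorphic_on ?S" for t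
      unfolding barnes_J_integrand_eq scaleR_conv_of_real
      by (cases "t > 0") (auto intro!: holomorphic_intros)
    fix \<alpha> assume \<alpha>: "\<alpha> \<in> ?S"
    define r where "r = (Re \<alpha> - (real d - real M - 1)) / 2"
    have r: "r > 0" "Re \<alpha> - r > real d - real M - 1" using \<alpha> by (auto simp: r_def field_simps)
    \<comment> \<open>The domination needs a right end beyond \<open>d\<close>; the maximum also
      covers all real parts in \<open>ball \<alpha> r\<close>.\<close>
    define a2 where "a2 = max (Re \<alpha> + r) (real d + 1)"
    have "a2 > real d" by (simp add: a2_def)
    from barnes_J_integrand_dominated[OF r(2) this] obtain g where g: "integrable lborel g"
      "\<And>\<beta> t. Re \<alpha> - r \<le> Re \<beta> \<Longrightarrow> Re \<beta> \<le> a2 \<Longrightarrow>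
         norm (indicator {0<..} t *\<^sub>R barnes_J_integrand d w M c \<beta> t) \<le> g t" by blast
    have "Re \<alpha> - r \<le> Re \<beta> \<and> Re \<beta> \<le> a2" if "\<beta> \<in> ball \<alpha> r" for \<beta>
    proof -
      have "\<bar>Re \<alpha> - Re \<beta>\<bar> < r"
        using abs_Re_le_cmod[of "\<alpha> - \<beta>"] that by (simp add: dist_norm)
      thus ?thesis unfolding a2_def by linarith
    qed
    thus "\<exists>r>0. \<exists>g. integrable lborel g \<and> (\<forall>\<beta>\<in>ball \<alpha> r. \<forall>t\<in>space lborel.
      norm (indicator {0<..} t *\<^sub>R barnes_J_integrand d w M c \<beta> t) \<le> g t)"
      using r(1) g by blast
  qed (rule barnes_J_integrand_measurable)
  thus ?thesis
    unfolding barnes_J_def set_lebesgue_integral_def by (intro holomorphic_intros)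
qed

end

section \<open>Meromorphic continuation\<close>

lemma pochhammer_ratio_Gamma:
  fixes \<alpha> :: complex
  assumes "\<alpha> - of_nat d \<notin> \<int>\<^sub>\<le>\<^sub>0"
  shows "pochhammer (\<alpha> - of_nat d) k / pochhammer (\<alpha> - of_nat d) d =
           Gamma (\<alpha> - of_nat d + of_nat k) / Gamma \<alpha>"
proof -
  have "Gamma (\<alpha> - of_nat d) \<noteq> 0" using assms by (simp add: Gamma_eq_zero_iff)
  thus ?thesis using assms by (simp add: pochhammer_Gamma)
qed

lemma holomorphic_pochhammer [holomorphic_intros]:
  assumes "f holomorphic_on A"
  shows "(\<lambda>z. pochhammer (f z :: complex) n) holomorphic_on A"
  unfolding pochhammer_prod by (intro holomorphic_intros assms)

lemma pochhammer_shifted_eq_0_iff: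
  "pochhammer (\<alpha> - of_nat d :: complex) d = 0 \<longleftrightarrow> \<alpha> \<in> of_nat ` {1..d}"
proof
  assume "pochhammer (\<alpha> - of_nat d) d = 0"
  then obtain j where j: "j < d" "\<alpha> - of_nat d = - of_nat j" by (auto simp: pochhammer_eq_0_iff)
  hence "\<alpha> = of_nat (d - j)" by (simp add: of_nat_diff algebra_simps)
  moreover have "d - j \<in> {1..d}" using j by auto
  ultimately show "\<alpha> \<in> of_nat ` {1..d}" by blast
next
  assume "\<alpha> \<in> of_nat ` {1..d}"
  then obtain k where k: "k \<in> {1..d}" "\<alpha> = of_nat k" by auto
  thus "pochhammer (\<alpha> - of_nat d) d = 0"
    by (auto simp: pochhammer_eq_0_iff of_nat_diff intro!: exI[of _ "d - k"])
qed

lemma eventually_at_not_Ints: "eventually (\<lambda>z::complex. z \<notin> \<int>) (at a)"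
proof -
  have "open (- (\<int> - {a}))" by (intro open_Compl closed_subset_Ints) auto
  hence "eventually (\<lambda>z. z \<in> - (\<int> - {a}) - {a}) (at a)"
    by (rule eventually_at_in_open) auto
  thus ?thesis by eventually_elim auto
qed

text \<open>The two sides agree off the integers, where no pole of \<open>Gamma\<close> interferes.
  That suffices near every point, because \<open>remove_sings\<close> depends only on punctured
  neighbourhoods and the rational function is analytic off \<open>{1..d}\<close>. In particular the
  default value \<open>0\<close> of \<open>Gamma\<close> at its poles does no harm.\<close>

lemma Gamma_quot_eq_pochhammer:
  assumes "\<alpha> \<notin> of_nat ` {1..d}"
  shows "Gamma_quot (int k - int d) \<alpha> =
           pochhammer (\<alpha> - of_nat d) k / pochhammer (\<alpha> - of_nat d) d"
proof -
  let ?f = "\<lambda>\<alpha>. pochhammer (\<alpha> - of_nat d) k / pochhammer (\<alpha> - of_nat d) d :: complex"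
  have "Gamma_quot (int k - int d) \<alpha> = remove_sings ?f \<alpha>"
    unfolding Gamma_quot_def
  proof (rule remove_sings_cong)
    show "eventually (\<lambda>\<alpha>. Gamma (\<alpha> + of_int (int k - int d)) / Gamma \<alpha> = ?f \<alpha>) (at \<alpha>)"
      using eventually_at_not_Ints
    proof eventually_elim
      case (elim \<beta>)
      hence "\<beta> - of_nat d \<notin> \<int>\<^sub>\<le>\<^sub>0"
        by (metis Ints_add Ints_of_nat diff_add_cancel nonpos_Ints_Int)
      from pochhammer_ratio_Gamma[OF this, of k] show ?case by (simp add: algebra_simps)
    qed
  qed simp
  also have "\<dots> = ?f \<alpha>"
  proof (rule remove_sings_at_analytic)
    have "?f holomorphic_on {\<alpha>. pochhammer (\<alpha> - of_nat d) d \<noteq> 0}"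
      by (intro holomorphic_intros) auto
    moreover have "{\<alpha>. pochhammer (\<alpha> - of_nat d) d \<noteq> (0::complex)} = - (of_nat ` {1..d})"
      by (auto simp: pochhammer_shifted_eq_0_iff)
    moreover have "open (- (of_nat ` {1..d} :: complex set))"
      by (intro open_Compl finite_imp_closed) auto
    ultimately show "?f analytic_on {\<alpha>}"
      using assms by (auto simp: analytic_at)
  qed
  finally show ?thesis .
qed

lemma Gamma_quot_nat: "Gamma_quot (int k) \<alpha> = pochhammer \<alpha> k"
  using Gamma_quot_eq_pochhammer[of \<alpha> 0 k] by simp

text \<open>All \<open>F M\<close> continue the same germ: two of them agree far to the right, hence
  by the identity theorem on the smaller of their half-planes. The half-planes are nested and
  exhaust the plane.\<close>

lemma holomorphic_halfplane_glue:
  fixes F :: "nat \<Rightarrow> complex \<Rightarrow> complex"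
  assumes hol: "\<And>M. F M holomorphic_on {z. Re z > a - real M}"
    and eq: "\<And>M z. Re z > b \<Longrightarrow> F M z = G z"
  obtains H where "H holomorphic_on UNIV" "\<And>M z. Re z > a - real M \<Longrightarrow> H z = F M z"
proof
  have agree: "F M z = F N z" if "Re z > a - real M" "Re z > a - real N" for M N z
  proof -
    define K where "K = min M N"
    let ?S' = "{z. Re z > a - real K}" and ?S = "{z. Re z > max b (a - real K)}"
    show ?thesis
    proof (rule analytic_continuation_open[of ?S ?S' "F M" "F N"])
      show "open ?S" "open ?S'" by (rule open_halfspace_Re_gt)+
      have "of_real (max b (a - real K) + 1) \<in> ?S" by (simp only: mem_Collect_eq Re_complex_of_real)
      thus "?S \<noteq> {}" by blast
      show "connected ?S'" by (intro convex_connected convex_halfspace_Re_gt)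
      show "F M holomorphic_on ?S'" "F N holomorphic_on ?S'"
        by (rule holomorphic_on_subset[OF hol[of M]] holomorphic_on_subset[OF hol[of N]]; auto simp: K_def)+
      show "z \<in> ?S'" using that by (simp add: K_def min_def)
    qed (auto simp: eq)
  qed
  \<comment> \<open>The index of some half-plane containing \<open>z\<close>; the \<open>+ 1\<close>
    makes the inequality strict.\<close>
  define m where "m = (\<lambda>z. nat \<lceil>a - Re z\<rceil> + 1)"
  have m: "Re z > a - real (m z)" for z
    using of_nat_ceiling[of "a - Re z"] by (simp add: m_def)
  define H where "H = (\<lambda>z. F (m z) z)"
  show H: "H z = F M z" if "Re z > a - real M" for M z
    unfolding H_def using m that by (rule agree)
  have "H holomorphic_on {z. Re z > a - real M}" for M
    using hol by (rule holomorphic_transform) (simp add: H)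
  hence "H holomorphic_on (\<Union>M\<in>UNIV. {z. Re z > a - real M})"
    by (intro holomorphic_on_UN_open open_halfspace_Re_gt)
  also have "(\<Union>M\<in>UNIV. {z. Re z > a - real M}) = UNIV" using m by blast
  finally show "H holomorphic_on UNIV" .
qed

text \<open>This gives the uniqueness behind \<open>barnes_zeta\<close>. The difference vanishes
  near a point of \<open>U\<close>, hence on a punctured neighbourhood of every point. Equality at
  the points themselves follows since a nicely meromorphic function is unchanged by
  \<open>remove_sings\<close>.\<close>

lemma nicely_meromorphic_unique:
  assumes f: "f nicely_meromorphic_on UNIV" and g: "g nicely_meromorphic_on UNIV"
    and eq: "\<And>z. z \<in> U \<Longrightarrow> f z = g z" and U: "open U" "U \<noteq> {}"
  shows "f = g"
proof
  fix z
  have "(\<lambda>z. f z - g z) meromorphic_on UNIV"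
    using f g by (intro meromorphic_intros) (auto simp: nicely_meromorphic_on_def)
  from meromorphic_imp_constant_or_avoid[OF this, of 0]
  have "(\<forall>z. eventually (\<lambda>z. f z - g z = 0) (at z)) \<or> (\<forall>z. eventually (\<lambda>z. f z - g z \<noteq> 0) (at z))"
    by (simp add: eventually_cosparse_open_eq connected_UNIV)
  moreover obtain u where u: "u \<in> U" using U by blast
  have "eventually (\<lambda>z. f z - g z = 0) (at u)"
    using eventually_at_in_open'[OF U(1) u] by (rule eventually_mono) (simp add: eq)
  hence "\<not> eventually (\<lambda>z. f z - g z \<noteq> 0) (at u)"
    by (auto dest: eventually_conj simp: eventually_False)
  ultimately have "eventually (\<lambda>z. f z = g z) (at z)" by auto
  hence "remove_sings f z = remove_sings g z" by (intro remove_sings_cong) auto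
  moreover have "remove_sings h z = h z" if "h nicely_meromorphic_on UNIV" for h
    using that unfolding nicely_meromorphic_on_def
    by (metis UNIV_I remove_sings_at_pole remove_sings_eqI)
  ultimately show "f z = g z" using f g by simp
qed

context
  fixes d :: nat and w :: "nat \<Rightarrow> complex" and c :: complex
  assumes d: "d \<ge> 1" and w: "\<forall>i\<in>{1..d}. Re (w i) > 0" and c: "Re c > 0"
begin

lemma barnes_rhs_eq_series:
  assumes \<alpha>: "Re \<alpha> > real d"
  shows "barnes_rhs d w M c \<alpha> = barnes_series d w \<alpha>"
proof -
  let ?W = "\<Prod>i=1..d. w i"
  have c0: "c \<noteq> 0" using c by auto
  have \<alpha>d: "\<alpha> - of_nat d \<notin> \<int>\<^sub>\<le>\<^sub>0" "\<alpha> \<notin> \<int>\<^sub>\<le>\<^sub>0" "\<alpha> \<notin> of_nat ` {1..d}"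
    using \<alpha> by (auto elim!: nonpos_Ints_cases simp: complex_eq_iff)
  have \<Gamma>: "Gamma \<alpha> \<noteq> 0" using \<alpha>d by (simp add: Gamma_eq_zero_iff)
  have 1: "Gamma_quot (int k - int d) \<alpha> = Gamma (\<alpha> - of_nat d + of_nat k) / Gamma \<alpha>" for k
    using Gamma_quot_eq_pochhammer[OF \<alpha>d(3)] pochhammer_ratio_Gamma[OF \<alpha>d(1)] by simp
  have 2: "Gamma_quot (int k) \<alpha> = Gamma (\<alpha> + of_nat k) / Gamma \<alpha>" for k
    using \<alpha>d by (simp add: Gamma_quot_nat pochhammer_Gamma)
  have "barnes_J d w M c \<alpha> = barnes_series d w \<alpha>
    - 1 / Gamma \<alpha> * (\<Sum>k\<le>M. (-1) ^ k * barnes_bernoulli k d w (-c) / fact k / ?W *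
         (Gamma (\<alpha> - of_nat d + of_nat k) * c powr (- (\<alpha> - of_nat d + of_nat k))))
    + 1 / Gamma \<alpha> * (\<Sum>k | k + d \<le> M. c ^ k / fact k * (Gamma (\<alpha> + of_nat k) * c powr (- (\<alpha> + of_nat k))))"
    unfolding barnes_J_def barnes_J_integral_right(2)[OF d w c \<alpha>] rGamma_inverse_Gamma
    using \<Gamma> by (simp only: ring_distribs) (simp add: divide_inverse)
  also have "1 / Gamma \<alpha> * (\<Sum>k\<le>M. (-1) ^ k * barnes_bernoulli k d w (-c) / fact k / ?W *
         (Gamma (\<alpha> - of_nat d + of_nat k) * c powr (- (\<alpha> - of_nat d + of_nat k)))) =
      1 / ?W * (\<Sum>k\<le>M. (-1) ^ k * barnes_bernoulli k d w (-c) * Gamma_quot (int k - int d) \<alpha> /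
                 (fact k * c powr (\<alpha> - of_nat d + of_nat k)))"
    unfolding sum_distrib_left 1 powr_minus
    by (intro sum.cong refl) (simp add: divide_inverse mult_ac)
  \<comment> \<open>The power \<open>c ^ k\<close> cancels against
    \<open>c powr (- (\<alpha> + of_nat k))\<close>, leaving one common
    \<open>c powr \<alpha>\<close> outside the sum.\<close>
  also have "1 / Gamma \<alpha> * (\<Sum>k | k + d \<le> M. c ^ k / fact k * (Gamma (\<alpha> + of_nat k) * c powr (- (\<alpha> + of_nat k)))) =
      1 / c powr \<alpha> * (\<Sum>k | k + d \<le> M. Gamma_quot (int k) \<alpha> / fact k)"
    unfolding sum_distrib_left 2 powr_minus powr_add
    using c0 by (intro sum.cong refl) (simp add: divide_inverse mult_ac)
  finally show ?thesis by (simp add: barnes_rhs_def)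
qed

text \<open>
  The right-hand side multiplied by \<open>(\<alpha> - 1) \<cdots> (\<alpha> - d)\<close>, so that the poles are cleared.
\<close>

definition barnes_cleared :: "nat \<Rightarrow> complex \<Rightarrow> complex" where
  "barnes_cleared M \<alpha> =
     1 / (\<Prod>i=1..d. w i) *
       (\<Sum>k\<le>M. (-1) ^ k * barnes_bernoulli k d w (-c) * pochhammer (\<alpha> - of_nat d) k /
                 (fact k * c powr (\<alpha> - of_nat d + of_nat k)))
     - pochhammer (\<alpha> - of_nat d) d / c powr \<alpha> * (\<Sum>k | k + d \<le> M. pochhammer \<alpha> k / fact k)
     + pochhammer (\<alpha> - of_nat d) d * barnes_J d w M c \<alpha>"

lemma holomorphic_barnes_cleared:
  "barnes_cleared M holomorphic_on {\<alpha>. Re \<alpha> > real d - 1 - real M}"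
proof -
  have "c \<noteq> 0" using c by auto
  moreover have "barnes_J d w M c holomorphic_on {\<alpha>. Re \<alpha> > real d - 1 - real M}"
    using holomorphic_barnes_J[where M = M, OF d w c] by (simp add: algebra_simps)
  ultimately show ?thesis
    unfolding barnes_cleared_def by (intro holomorphic_intros) auto
qed

lemma barnes_rhs_eq_cleared:
  assumes "\<alpha> \<notin> of_nat ` {1..d}"
  shows "barnes_rhs d w M c \<alpha> = barnes_cleared M \<alpha> / pochhammer (\<alpha> - of_nat d) d"
proof -
  have nz: "pochhammer (\<alpha> - of_nat d) d \<noteq> 0" using assms pochhammer_shifted_eq_0_iff by blast
  show ?thesis
    unfolding barnes_rhs_def barnes_cleared_def Gamma_quot_eq_pochhammer[OF assms] Gamma_quot_nat
      add_divide_distrib diff_divide_distrib sum_distrib_left sum_divide_distrib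
    using nz by (simp add: mult_ac)
qed

text \<open>At a point of \<open>{1..d}\<close> a summand of \<open>barnes_rhs\<close> may take the
  default value \<open>0\<close> of a pole while others stay finite, so its value there need not be
  that of the continuation. Hence there are two forms: with \<open>remove_sings\<close> on the whole
  half-plane, and literal equality off \<open>{1..d}\<close>.\<close>

lemma barnes_zeta_continuation:
  shows "barnes_zeta d w nicely_meromorphic_on UNIV"
    and "Re \<alpha> > real d \<Longrightarrow> barnes_zeta d w \<alpha> = barnes_series d w \<alpha>"
    and "Re \<alpha> > real d - real M - 1 \<Longrightarrow> barnes_zeta d w \<alpha> = remove_sings (barnes_rhs d w M c) \<alpha>"
    and "Re \<alpha> > real d - real M - 1 \<Longrightarrow> \<alpha> \<notin> of_nat ` {1..d} \<Longrightarrow>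
           barnes_zeta d w \<alpha> = barnes_rhs d w M c \<alpha>"
proof -
  let ?P = "\<lambda>\<alpha>. pochhammer (\<alpha> - of_nat d) d :: complex"
  let ?E = "of_nat ` {1..d} :: complex set"
  have not_E: "\<alpha> \<notin> ?E" if "Re \<alpha> > real d" for \<alpha> using that by auto
  have right: "barnes_cleared M \<alpha> = ?P \<alpha> * barnes_series d w \<alpha>" if "Re \<alpha> > real d" for M \<alpha>
    using barnes_rhs_eq_cleared[OF not_E[OF that]] barnes_rhs_eq_series[OF that]
      pochhammer_shifted_eq_0_iff not_E[OF that] by (simp add: field_simps)
  obtain H where H: "H holomorphic_on UNIV"
    "\<And>M \<alpha>. Re \<alpha> > real d - 1 - real M \<Longrightarrow> H \<alpha> = barnes_cleared M \<alpha>"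
    using holomorphic_halfplane_glue[of barnes_cleared "real d - 1" "real d"]
      holomorphic_barnes_cleared right by metis
  \<comment> \<open>\<open>H\<close> does not depend on \<open>M\<close>, so this one candidate
    serves all half-planes; \<open>remove_sings\<close> gives it the normalised values that the
    definite description requires.\<close>
  define f where "f = remove_sings (\<lambda>\<alpha>. H \<alpha> / ?P \<alpha>)"
  have quot: "H \<alpha> / ?P \<alpha> = barnes_rhs d w M c \<alpha>" if "Re \<alpha> > real d - real M - 1" "\<alpha> \<notin> ?E" for \<alpha> M
    using barnes_rhs_eq_cleared[OF that(2)] H(2)[of M \<alpha>] that(1) by simp
  have H_an: "H analytic_on A" for A
    using H(1) by (meson analytic_on_holomorphic open_UNIV subset_UNIV)
  have P_an: "?P analytic_on A" for A
    unfolding analytic_on_holomorphic by (intro exI[of _ UNIV] conjI holomorphic_intros) auto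
  have "(\<lambda>\<alpha>. H \<alpha> / ?P \<alpha>) meromorphic_on UNIV"
    by (intro meromorphic_intros analytic_on_imp_meromorphic_on H_an P_an)
  hence mero: "f nicely_meromorphic_on UNIV"
    unfolding f_def by (rule remove_sings_nicely_meromorphic)
  have f_off: "f \<alpha> = barnes_rhs d w M c \<alpha>" if "Re \<alpha> > real d - real M - 1" "\<alpha> \<notin> ?E" for \<alpha> M
  proof -
    have "(\<lambda>\<alpha>. H \<alpha> / ?P \<alpha>) analytic_on {\<alpha>}"
      using that(2) pochhammer_shifted_eq_0_iff by (intro analytic_on_divide H_an P_an) auto
    thus ?thesis using quot[OF that] by (simp add: f_def)
  qed
  have f_all: "f \<alpha> = remove_sings (barnes_rhs d w M c) \<alpha>" if "Re \<alpha> > real d - real M - 1" for \<alpha> M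
    unfolding f_def
  proof (rule remove_sings_cong)
    let ?S = "{\<alpha>. Re \<alpha> > real d - real M - 1}"
    have "eventually (\<lambda>\<beta>. \<beta> \<in> ?S) (at \<alpha>)"
      using that by (intro eventually_at_in_open' open_halfspace_Re_gt) auto
    moreover have "eventually (\<lambda>\<beta>. \<beta> \<notin> \<int>) (at \<alpha>)" by (rule eventually_at_not_Ints)
    ultimately show "eventually (\<lambda>\<beta>. H \<beta> / ?P \<beta> = barnes_rhs d w M c \<beta>) (at \<alpha>)"
      by eventually_elim (rule quot, auto)
  qed simp
  have f_right: "f \<alpha> = barnes_series d w \<alpha>" if "Re \<alpha> > real d" for \<alpha>
    using f_off[of 0 \<alpha>] that not_E[OF that] barnes_rhs_eq_series[OF that, of 0] by simp
  have "barnes_zeta d w = f"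
    unfolding barnes_zeta_def
  proof (rule the_equality)
    show "f nicely_meromorphic_on UNIV \<and> (\<forall>\<alpha>. Re \<alpha> > real d \<longrightarrow> f \<alpha> = barnes_series d w \<alpha>)"
      using mero f_right by blast
    fix g assume g: "g nicely_meromorphic_on UNIV \<and> (\<forall>\<alpha>. Re \<alpha> > real d \<longrightarrow> g \<alpha> = barnes_series d w \<alpha>)"
    show "g = f"
    proof (rule nicely_meromorphic_unique)
      show "open {\<alpha>. Re \<alpha> > real d}" by (rule open_halfspace_Re_gt)
      have "of_real (real d + 1) \<in> {\<alpha>. Re \<alpha> > real d}" by simp
      thus "{\<alpha>. Re \<alpha> > real d} \<noteq> {}" by blast
    qed (use g mero f_right in auto)
  qed
  thus "barnes_zeta d w nicely_meromorphic_on UNIV"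
    and "Re \<alpha> > real d \<Longrightarrow> barnes_zeta d w \<alpha> = barnes_series d w \<alpha>"
    and "Re \<alpha> > real d - real M - 1 \<Longrightarrow> barnes_zeta d w \<alpha> = remove_sings (barnes_rhs d w M c) \<alpha>"
    and "Re \<alpha> > real d - real M - 1 \<Longrightarrow> \<alpha> \<notin> of_nat ` {1..d} \<Longrightarrow>
           barnes_zeta d w \<alpha> = barnes_rhs d w M c \<alpha>"
    using mero f_right f_all f_off by auto
qed

end

theorem mainTheorem10:
  fixes d M :: nat and w :: "nat \<Rightarrow> complex" and c :: complex
  assumes "d \<ge> 1"
    and "\<And>i. i \<in> {1..d} \<Longrightarrow> Re (w i) > 0"
    and "Re c > 0"
  shows "(\<forall>\<alpha>. Re \<alpha> > real d \<longrightarrow> barnes_term d w \<alpha> summable_on nonzero_indices d)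
    \<and> barnes_zeta d w nicely_meromorphic_on UNIV
    \<and> (\<forall>\<alpha>. Re \<alpha> > real d \<longrightarrow> barnes_zeta d w \<alpha> = barnes_series d w \<alpha>)
    \<and> (\<forall>\<alpha>. Re \<alpha> > real d - real M - 1 \<longrightarrow>
         set_integrable lborel {0<..} (barnes_J_integrand d w M c \<alpha>))
    \<and> (\<forall>\<alpha>. Re \<alpha> > real d - real M - 1 \<longrightarrow>
         barnes_zeta d w \<alpha> = remove_sings (barnes_rhs d w M c) \<alpha>)
    \<and> (\<forall>\<alpha>. Re \<alpha> > real d - real M - 1 \<and> \<alpha> \<notin> of_nat ` {1..d} \<longrightarrow>
         barnes_zeta d w \<alpha> = barnes_rhs d w M c \<alpha>)"
proof -
  have w: "\<forall>i\<in>{1..d}. Re (w i) > 0" using assms(2) by blast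
  show ?thesis
    using barnes_mellin(1)[OF assms(1) w] barnes_zeta_continuation[OF assms(1) w assms(3)]
      barnes_J_integrand_integrable[OF assms(1) w assms(3)]
    by blast
qed

end
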